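(* Let $\nabla=d+(p_{-1}+u)dt$ be a cyclotomic Miura $\mathfrak g$-oper as in the setting described in the context. Let $\mathcal I\in I/\nu$ be an orbit of type $A_1^{\times|\mathcal I|}$. Fix $k\in\mathcal I$ and let $f_k\in\mathcal M$ be any non-zero solution of the Riccati equation $$f_k'(t)+f_k(t)^2+f_k(t)\langle\alpha_k,u(t)\rangle=0.$$ Define $f_i\in\mathcal M$ for all $i\in\mathcal I\setminus\{k\}$ recursively by $f_i(t):=\omega^{-1}f_{\nu^{-1}(i)}(\omega^{-1}t)$ and let $g=\prod_{i\in\mathcal I}e^{f_iE_i}\in N(\mathcal M)$. (1) If $f_k$ is regular at the origin, then $g\in N^{\hat\varsigma}(\mathcal M)$, and hence $g\nabla g^{-1}\in\mathrm{MOp}^\Gamma_{\mathfrak g}(\mathbb P^1)$, if and only if $$\langle\alpha_k,\check\lambda_0+\check\rho\rangle\equiv0\mod\frac{T}{|\mathcal I|}.$$ Moreover, in this case $\operatorname{res}_0\overline{g\nabla g^{-1}}=\operatorname{res}_0\overline\nabla$. (2) If $f_k$ has a pole at the origin, then $g\nabla g^{-1}\in\mathrm{MOp}^\Gamma_{\mathfrak g}(\mathbb P^1)$ without any condition on $\check\lambda_0$, and $-\operatorname{res}_0\overline{g\nabla g^{-1}}=s^\nu_{\mathcal I}\cdot(-\operatorname{res}_0\overline\nabla)$. (3) If $\langle\alpha_k,\operatorname{res}_\infty\overline\nabla+\check\rho\rangle$ is non-negative, then $\operatorname{res}_\infty\overline{g\nabla g^{-1}}=s^\nu_{\mathcal I}\cdot(\operatorname{res}_\infty\overline\nabla)$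 (whether $f_k$ is regular or singular at the origin).
   Context: **Lie algebra.** $\mathfrak g$ is a finite-dimensional complex semisimple Lie algebra with Cartan subalgebra $\mathfrak h$, simple roots $\alpha_i$ ($i\in I$), Cartan matrix $a_{ij}=\langle\alpha_j,\check\alpha_i\rangle$, Chevalley-Serre generators $E_i,\check\alpha_i,F_i$, and $\mathfrak g=\mathfrak n_-\oplus\mathfrak h\oplus\mathfrak n$, $\mathfrak b=\mathfrak h\oplus\mathfrak n$. $G$ is the adjoint group, $N\subset G$ the unipotent subgroup with Lie algebra $\mathfrak n$, $W$ the Weyl group, with simple reflections $s_i$, acting on $\mathfrak h$. A coweight $\check\lambda\in\mathfrak h$ is integral if all $\langle\alpha_i,\check\lambda\rangle\in\mathbb Z$ and dominant if all $\langle\alpha_i,\check\lambda\rangle\ge 0$. $\check\rho\in\mathfrak h$ is defined by $\langle\alpha_i,\check\rho\rangle=1$ for all $i$; $p_{-1}=\sum_i F_i$; $2\check\rho=\sum_i c_i\check\alpha_i$, $p_1=\sum_i c_iE_i$, $\mathfrak a=\ker(\operatorname{ad}_{p_1})$. Shifted action: $w\cdot\check\lambda=w(\check\lambda+\check\rho)-\check\rho$. **Cyclotomic data.** $\nu:I\to I$ is a diagram automorphism ($a_{\nu(i)\nu(j)}=a_{ij}$), also denoting the automorphism $E_i\mapsto E_{\nu(i)}$, $\check\alpha_i\mapsto\check\alpha_{\nu(i)}$, $F_i\mapsto F_{\nu(i)}$ of $\mathfrak g$; it acts on $W$ by conjugation; $W^\nu$, $\mathfrak h^\nu$ denote invariants;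 $I/\nu$ is the set of $\nu$-orbits in $I$. $T\ge 1$ is a multiple of the order of $\nu$, $\omega$ a primitive $T$-th root of unity, $\Gamma=\langle\omega\rangle$, acting on $\mathbb P^1$ (coordinate $t$) by multiplication. $\mathcal M$ is the algebra of meromorphic (rational) functions on $\mathbb P^1$; $\Omega(\mathfrak p)=\mathfrak p\otimes\mathcal M\,dt$. For an automorphism $\upsilon$ of $\mathfrak g$ with $\upsilon^T=\mathrm{Id}$ (lifted to $G$ by conjugation), $\hat\upsilon$ acts on $G(\mathcal M)$ by $(\hat\upsilon g)(t)=\upsilon(g(\omega^{-1}t))$ and on $\Omega(\mathfrak g)$ by $\hat\upsilon(X\otimes\varpi)=\upsilon(X)\otimes\mu_{\omega^{-1}}^*\varpi$, where $\mu_{\omega^{-1}}(t)=\omega^{-1}t$; a superscript $\hat\upsilon$ denotes invariants. Let $\varsigma$ be the automorphism $E_i\mapsto\omega^{-1}E_{\nu(i)}$, $\check\alpha_i\mapsto\check\alpha_{\nu(i)}$, $F_i\mapsto\omega F_{\nu(i)}$. **Opers.** $G(\mathcal M)$ acts on connections $d+A$, $A\in\Omega(\mathfrak g)$, by $g(d+A)g^{-1}=d-dg\,g^{-1}+\operatorname{Ad}_gA$. For $\nabla=d+p_{-1}dt+v$ with $v\in\Omega^{\hat\varsigma}(\mathfrak b)$, $[\nabla]_\Gamma$ denotes its $N^{\hat\varsigma}(\mathcal M)$-orbit, which has a unique canonical representative $d+p_{-1}dt+c$, $c\in\Omega^{\hat\varsigma}(\mathfrak a)$; $[\nabla]_\Gamma$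 is regular at $x\in\mathbb C$ if $c$ has no pole at $x$. $\mathrm{MOp}^\Gamma_{\mathfrak g}(\mathbb P^1)$ is the set of cyclotomic Miura $\mathfrak g$-opers $d+p_{-1}dt+u\,dt$, $u\,dt\in\Omega^{\hat\nu}(\mathfrak h)$. For a connection $\nabla=d+p_{-1}dt+A$ put $\overline\nabla=\nabla-p_{-1}dt=d+A$, with $\operatorname{res}_x\overline\nabla=\operatorname{res}_xA$. **Setting for $\nabla$.** $z_1,\dots,z_L\in\mathbb C^\times$ have pairwise disjoint $\Gamma$-orbits, $\check\lambda_1,\dots,\check\lambda_L\in\mathfrak h$ and $\check\lambda_0,\check\lambda_\infty\in\mathfrak h^\nu$ are integral dominant coweights, and $\nabla=d+(p_{-1}+u)dt$ with $$u(t)=-\frac{\check\lambda_0}{t}-\sum_{r=0}^{T-1}\Big(\sum_{i=1}^L\frac{\nu^r(w_i\cdot\check\lambda_i)}{t-\omega^rz_i}+\sum_{j=1}^m\frac{\nu^r(y_j\cdot 0)}{t-\omega^rx_j}\Big),$$ with $w_i,y_j\in W$, $m\ge0$, $x_j\in\mathbb C^\times$ outside the $\Gamma$-orbits of the $z_i$, such that $[\nabla]_\Gamma$ is regular at every $x_j$ and $\operatorname{res}_\infty(u\,dt)=w_\infty\cdot\check\lambda_\infty$ for some $w_\infty\in W^\nu$. **Orbits.** $\mathcal I\in I/\nu$ is of type $A_1^{\times|\mathcal I|}$ if $a_{ij}=0$ for all distinct $i,j\in\mathcal I$ (so the $E_i$, $i\in\mathcal I$, commute). Then $s^\nu_{\mathcal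 I}=\prod_{i\in\mathcal I}s_i\in W^\nu$. *)

theory Defs
  imports
    "HOL-Analysis.Analysis"
    "HOL-Computational_Algebra.Computational_Algebra"
    "HOL-Computational_Algebra.Field_as_Ring"
    "HOL-Number_Theory.Cong"
begin

section \<open>Rational functions on the projective line\<close>

text \<open>The algebra of meromorphic functions on the projective line is the field of fractions of
  \<open>complex poly\<close>, the coordinate being the class of \<open>[:0, 1:]\<close>.\<close>

type_synonym ratfun = "complex poly fract"

definition rconst :: "complex \<Rightarrow> ratfun" where
  "rconst c = Fraction_Field.Fract [:c:] 1"

text \<open>The function \<open>1 / (t - a)\<close>.\<close>

definition rpole :: "complex \<Rightarrow> ratfun" where
  "rpole a = Fraction_Field.Fract 1 [:- a, 1:]"

definition rderiv :: "ratfun \<Rightarrow> ratfun" where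
  "rderiv r = (case quot_of_fract r of (p, q) \<Rightarrow>
     Fraction_Field.Fract (pderiv p * q - p * pderiv q) (q * q))"

text \<open>The function \<open>t \<mapsto> r (c t)\<close>, for \<open>c \<noteq> 0\<close>.\<close>

definition rscale :: "complex \<Rightarrow> ratfun \<Rightarrow> ratfun" where
  "rscale c r = (case quot_of_fract r of (p, q) \<Rightarrow>
     Fraction_Field.Fract (pcompose p [:0, c:]) (pcompose q [:0, c:]))"

definition regular_at :: "complex \<Rightarrow> ratfun \<Rightarrow> bool" where
  "regular_at a r \<longleftrightarrow> (\<exists>p q. poly q a \<noteq> 0 \<and> r = Fraction_Field.Fract p q)"

text \<open>The image of a rational function under the substitution of a Laurent series for \<open>t\<close>;
  used only for the transcendental series \<open>a + s\<close> and \<open>1 / s\<close>, where no denominator vanishes.\<close>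

definition rsubst :: "complex fls \<Rightarrow> ratfun \<Rightarrow> complex fls" where
  "rsubst s r = (case quot_of_fract r of (p, q) \<Rightarrow>
     poly (map_poly fls_const p) s / poly (map_poly fls_const q) s)"

text \<open>Residues of the one-form \<open>r dt\<close>; at infinity \<open>t = 1 / s\<close> and \<open>dt = - ds / s\<^sup>2\<close>.\<close>

definition rres :: "complex \<Rightarrow> ratfun \<Rightarrow> complex" where
  "rres a r = fls_residue (rsubst (fls_const a + fls_X) r)"

definition rres_inf :: "ratfun \<Rightarrow> complex" where
  "rres_inf r = fls_residue (- (fls_X_inv ^ 2) * rsubst fls_X_inv r)"


section \<open>Semisimple Lie algebras with simple roots and Chevalley-Serre generators\<close>

text \<open>The Lie algebra is the whole type \<open>'g\<close>. The basis \<open>bas\<close>, indexed by a finite type, is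
  an arbitrary one; it only serves to write tensor products with the field of rational functions in
  coordinates. The simple root \<open>rt i\<close> is given as a linear form on \<open>'g\<close>, of which only the
  restriction to the Cartan subalgebra \<open>csa\<close> is ever constrained or used.\<close>

record ('g, 'n, 'i) lie_data =
  scl :: "complex \<Rightarrow> 'g \<Rightarrow> 'g"
  br :: "'g \<Rightarrow> 'g \<Rightarrow> 'g"
  bas :: "'n \<Rightarrow> 'g"
  csa :: "'g set"
  rt :: "'i \<Rightarrow> 'g \<Rightarrow> complex"
  genE :: "'i \<Rightarrow> 'g"
  coroot :: "'i \<Rightarrow> 'g"
  genF :: "'i \<Rightarrow> 'g"

locale lie_algebra =
  fixes D :: "('g::ab_group_add, 'n::finite, 'i::finite) lie_data"
  assumes vector_space: "vector_space (scl D)"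
    and bas_inj: "inj (bas D)"
    and bas_independent: "\<not> module.dependent (scl D) (range (bas D))"
    and bas_span: "module.span (scl D) (range (bas D)) = UNIV"
    and br_add_left: "br D (x + y) z = br D x z + br D y z"
    and br_add_right: "br D x (y + z) = br D x y + br D x z"
    and br_scl_left: "br D (scl D c x) y = scl D c (br D x y)"
    and br_scl_right: "br D x (scl D c y) = scl D c (br D x y)"
    and br_self: "br D x x = 0"
    and jacobi: "br D x (br D y z) + br D y (br D z x) + br D z (br D x y) = 0"

definition br_span :: "('g::ab_group_add, 'n, 'i) lie_data \<Rightarrow> 'g set \<Rightarrow> 'g set \<Rightarrow> 'g set" where
  "br_span D A B = module.span (scl D) {br D a b | a b. a \<in> A \<and> b \<in> B}"

definition lie_ideal :: "('g::ab_group_add, 'n, 'i) lie_data \<Rightarrow> 'g set \<Rightarrow> bool" where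
  "lie_ideal D J \<longleftrightarrow> module.subspace (scl D) J \<and> (\<forall>x. \<forall>y\<in>J. br D x y \<in> J)"

definition lie_subalgebra :: "('g::ab_group_add, 'n, 'i) lie_data \<Rightarrow> 'g set \<Rightarrow> bool" where
  "lie_subalgebra D S \<longleftrightarrow> module.subspace (scl D) S \<and> (\<forall>x\<in>S. \<forall>y\<in>S. br D x y \<in> S)"

definition lie_generated :: "('g::ab_group_add, 'n, 'i) lie_data \<Rightarrow> 'g set \<Rightarrow> 'g set" where
  "lie_generated D X = \<Inter>{S. lie_subalgebra D S \<and> X \<subseteq> S}"

definition lie_solvable :: "('g::ab_group_add, 'n, 'i) lie_data \<Rightarrow> 'g set \<Rightarrow> bool" where
  "lie_solvable D S \<longleftrightarrow> (\<exists>n. ((\<lambda>A. br_span D A A) ^^ n) S = {0})"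

definition lie_nilpotent :: "('g::ab_group_add, 'n, 'i) lie_data \<Rightarrow> 'g set \<Rightarrow> bool" where
  "lie_nilpotent D S \<longleftrightarrow> (\<exists>n. ((\<lambda>A. br_span D S A) ^^ n) S = {0})"

definition semisimple :: "('g::ab_group_add, 'n, 'i) lie_data \<Rightarrow> bool" where
  "semisimple D \<longleftrightarrow> (\<forall>J. lie_ideal D J \<and> lie_solvable D J \<longrightarrow> J = {0})"

definition cartan_subalgebra :: "('g::ab_group_add, 'n, 'i) lie_data \<Rightarrow> 'g set \<Rightarrow> bool" where
  "cartan_subalgebra D S \<longleftrightarrow> lie_subalgebra D S \<and> lie_nilpotent D S \<and>
     {x. \<forall>y\<in>S. br D x y \<in> S} = S"

definition root_space :: "('g::ab_group_add, 'n, 'i) lie_data \<Rightarrow> ('g \<Rightarrow> complex) \<Rightarrow> 'g set" where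
  "root_space D a = {x. \<forall>y\<in>csa D. br D y x = scl D (a y) x}"

definition is_root :: "('g::ab_group_add, 'n, 'i) lie_data \<Rightarrow> ('g \<Rightarrow> complex) \<Rightarrow> bool" where
  "is_root D a \<longleftrightarrow> Vector_Spaces.linear (scl D) (*) a \<and> (\<exists>y\<in>csa D. a y \<noteq> 0) \<and>
     (\<exists>x\<in>root_space D a. x \<noteq> 0)"

definition simple_roots :: "('g::ab_group_add, 'n, 'i::finite) lie_data \<Rightarrow> bool" where
  "simple_roots D \<longleftrightarrow> (\<forall>i. is_root D (rt D i)) \<and>
     (\<forall>c. (\<forall>y\<in>csa D. (\<Sum>i\<in>UNIV. c i * rt D i y) = 0) \<longrightarrow> (\<forall>i. c i = 0)) \<and>
     (\<forall>a. is_root D a \<longrightarrow> (\<exists>n :: 'i \<Rightarrow> nat.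
        (\<forall>y\<in>csa D. a y = (\<Sum>i\<in>UNIV. of_nat (n i) * rt D i y)) \<or>
        (\<forall>y\<in>csa D. a y = - (\<Sum>i\<in>UNIV. of_nat (n i) * rt D i y))))"

definition cartan_matrix :: "('g, 'n, 'i) lie_data \<Rightarrow> 'i \<Rightarrow> 'i \<Rightarrow> complex" where
  "cartan_matrix D i j = rt D j (coroot D i)"

definition chevalley_serre :: "('g::ab_group_add, 'n, 'i) lie_data \<Rightarrow> bool" where
  "chevalley_serre D \<longleftrightarrow>
     (\<forall>i. genE D i \<in> root_space D (rt D i) \<and> genF D i \<in> root_space D (\<lambda>y. - rt D i y) \<and>
          coroot D i \<in> csa D \<and> cartan_matrix D i i = 2) \<and>
     (\<forall>i j. br D (genE D i) (genF D j) = (if i = j then coroot D i else 0)) \<and>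
     (\<forall>i j. i \<noteq> j \<longrightarrow> (\<exists>n :: nat. cartan_matrix D i j = - of_nat n \<and>
          (br D (genE D i) ^^ (n + 1)) (genE D j) = 0 \<and>
          (br D (genF D i) ^^ (n + 1)) (genF D j) = 0)) \<and>
     lie_generated D (range (genE D) \<union> range (coroot D) \<union> range (genF D)) = UNIV"

locale semisimple_lie_data = lie_algebra +
  assumes semisimple: "semisimple D"
    and cartan: "cartan_subalgebra D (csa D)"
    and simple_roots: "simple_roots D"
    and chevalley_serre: "chevalley_serre D"

definition nil_plus :: "('g::ab_group_add, 'n, 'i) lie_data \<Rightarrow> 'g set" where
  "nil_plus D = lie_generated D (range (genE D))"

definition rho :: "('g::ab_group_add, 'n, 'i) lie_data \<Rightarrow> 'g" where
  "rho D = (THE x. x \<in> csa D \<and> (\<forall>i. rt D i x = 1))"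

definition rho_coeff :: "('g::ab_group_add, 'n, 'i::finite) lie_data \<Rightarrow> 'i \<Rightarrow> complex" where
  "rho_coeff D = (THE c. scl D 2 (rho D) = (\<Sum>i\<in>UNIV. scl D (c i) (coroot D i)))"

definition p_minus :: "('g::ab_group_add, 'n, 'i::finite) lie_data \<Rightarrow> 'g" where
  "p_minus D = (\<Sum>i\<in>UNIV. genF D i)"

definition p_plus :: "('g::ab_group_add, 'n, 'i::finite) lie_data \<Rightarrow> 'g" where
  "p_plus D = (\<Sum>i\<in>UNIV. scl D (rho_coeff D i) (genE D i))"

definition ker_ad_p_plus :: "('g::ab_group_add, 'n, 'i::finite) lie_data \<Rightarrow> 'g set" where
  "ker_ad_p_plus D = {x. br D (p_plus D) x = 0}"

definition integral_coweight :: "('g, 'n, 'i) lie_data \<Rightarrow> 'g \<Rightarrow> bool" where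
  "integral_coweight D l \<longleftrightarrow> l \<in> csa D \<and> (\<forall>i. rt D i l \<in> \<int>)"

definition dominant_coweight :: "('g, 'n, 'i) lie_data \<Rightarrow> 'g \<Rightarrow> bool" where
  "dominant_coweight D l \<longleftrightarrow> l \<in> csa D \<and> (\<forall>i. rt D i l \<in> \<real>\<^sub>\<ge>\<^sub>0)"

text \<open>Elements of the Weyl group are represented by maps on all of \<open>'g\<close>; only their
  restrictions to the Cartan subalgebra are meaningful.\<close>

definition simple_refl :: "('g::ab_group_add, 'n, 'i) lie_data \<Rightarrow> 'i \<Rightarrow> 'g \<Rightarrow> 'g" where
  "simple_refl D i x = x - scl D (rt D i x) (coroot D i)"

inductive_set weyl :: "('g::ab_group_add, 'n, 'i) lie_data \<Rightarrow> ('g \<Rightarrow> 'g) set"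
  for D :: "('g::ab_group_add, 'n, 'i) lie_data" where
  weyl_id: "id \<in> weyl D"
| weyl_refl: "w \<in> weyl D \<Longrightarrow> simple_refl D i \<circ> w \<in> weyl D"

definition weyl_inv :: "('g::ab_group_add, 'n, 'i) lie_data \<Rightarrow> ('g \<Rightarrow> 'g) \<Rightarrow> ('g \<Rightarrow> 'g) set" where
  "weyl_inv D \<nu> = {w \<in> weyl D. \<forall>x\<in>csa D. \<nu> (w x) = w (\<nu> x)}"

definition weyl_dot :: "('g::ab_group_add, 'n, 'i) lie_data \<Rightarrow> ('g \<Rightarrow> 'g) \<Rightarrow> 'g \<Rightarrow> 'g" where
  "weyl_dot D w l = w (l + rho D) - rho D"

definition lie_automorphism :: "('g::ab_group_add, 'n, 'i) lie_data \<Rightarrow> ('g \<Rightarrow> 'g) \<Rightarrow> bool" where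
  "lie_automorphism D \<phi> \<longleftrightarrow> Vector_Spaces.linear (scl D) (scl D) \<phi> \<and> bij \<phi> \<and>
     (\<forall>x y. \<phi> (br D x y) = br D (\<phi> x) (\<phi> y))"

definition diagram_automorphism :: "('g, 'n, 'i) lie_data \<Rightarrow> ('i \<Rightarrow> 'i) \<Rightarrow> bool" where
  "diagram_automorphism D \<nu> \<longleftrightarrow> bij \<nu> \<and>
     (\<forall>i j. cartan_matrix D (\<nu> i) (\<nu> j) = cartan_matrix D i j)"

text \<open>The automorphism \<open>E\<^sub>i \<mapsto> c\<inverse> E\<^sub>\<nu>\<^sub>i\<close>, \<open>\<alpha>\<^sub>i \<mapsto> \<alpha>\<^sub>\<nu>\<^sub>i\<close> (coroots), \<open>F\<^sub>i \<mapsto> c F\<^sub>\<nu>\<^sub>i\<close>: the one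
  attached to the diagram automorphism itself for \<open>c = 1\<close>, and its cyclotomic twist for
  \<open>c = \<omega>\<close>.\<close>

definition twisted_automorphism ::
  "('g::ab_group_add, 'n, 'i) lie_data \<Rightarrow> ('i \<Rightarrow> 'i) \<Rightarrow> complex \<Rightarrow> ('g \<Rightarrow> 'g) \<Rightarrow> bool" where
  "twisted_automorphism D \<nu> c \<phi> \<longleftrightarrow> lie_automorphism D \<phi> \<and>
     (\<forall>i. \<phi> (genE D i) = scl D (inverse c) (genE D (\<nu> i)) \<and>
          \<phi> (coroot D i) = coroot D (\<nu> i) \<and>
          \<phi> (genF D i) = scl D c (genF D (\<nu> i)))"

definition diagram_orbits :: "('i \<Rightarrow> 'i) \<Rightarrow> 'i set set" where
  "diagram_orbits \<nu> = range (\<lambda>i. {(\<nu> ^^ r) i | r. True})"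

definition type_A1_power :: "('g, 'n, 'i) lie_data \<Rightarrow> 'i set \<Rightarrow> bool" where
  "type_A1_power D J \<longleftrightarrow> (\<forall>i\<in>J. \<forall>j\<in>J. i \<noteq> j \<longrightarrow> cartan_matrix D i j = 0)"

text \<open>Composite of the maps \<open>h i\<close> along a list of indices; applied to enumerations of an orbit
  for which the factors commute, so that the result does not depend on the enumeration.\<close>

definition comp_prod :: "('i \<Rightarrow> 'a \<Rightarrow> 'a) \<Rightarrow> 'i list \<Rightarrow> 'a \<Rightarrow> 'a" where
  "comp_prod h is = foldr (\<lambda>i w. h i \<circ> w) is id"


section \<open>Extension of scalars to rational functions\<close>

text \<open>The tensor product of \<open>'g\<close> with \<open>ratfun\<close> is \<open>ratfun ^ 'n\<close>, through coordinates with respect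
  to the basis \<open>bas D\<close>. The one-form \<open>A dt\<close> is represented by \<open>A\<close>.\<close>

definition coord :: "('g::ab_group_add, 'n, 'i) lie_data \<Rightarrow> 'g \<Rightarrow> 'n \<Rightarrow> complex" where
  "coord D x n = module.representation (scl D) (range (bas D)) x (bas D n)"

definition tensor :: "('g::ab_group_add, 'n::finite, 'i) lie_data \<Rightarrow> 'g \<Rightarrow> ratfun \<Rightarrow> ratfun ^ 'n" where
  "tensor D x r = (\<chi> n. r * rconst (coord D x n))"

definition tconst :: "('g::ab_group_add, 'n::finite, 'i) lie_data \<Rightarrow> 'g \<Rightarrow> ratfun ^ 'n" where
  "tconst D x = tensor D x 1"

definition tspace :: "('g::ab_group_add, 'n::finite, 'i) lie_data \<Rightarrow> 'g set \<Rightarrow> (ratfun ^ 'n) set" where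
  "tspace D S = vec.span (tconst D ` S)"

definition tbr ::
  "('g::ab_group_add, 'n::finite, 'i) lie_data \<Rightarrow> ratfun ^ 'n \<Rightarrow> ratfun ^ 'n \<Rightarrow> ratfun ^ 'n" where
  "tbr D X Y = (\<Sum>m\<in>UNIV. \<Sum>n\<in>UNIV. tensor D (br D (bas D m) (bas D n)) (X $ m * Y $ n))"

definition tmap ::
  "('g::ab_group_add, 'n::finite, 'i) lie_data \<Rightarrow> ('g \<Rightarrow> 'g) \<Rightarrow> ratfun ^ 'n \<Rightarrow> ratfun ^ 'n" where
  "tmap D \<phi> X = (\<Sum>n\<in>UNIV. tensor D (\<phi> (bas D n)) (X $ n))"

definition tpair :: "('g, 'n::finite, 'i) lie_data \<Rightarrow> 'i \<Rightarrow> ratfun ^ 'n \<Rightarrow> ratfun" where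
  "tpair D i X = (\<Sum>n\<in>UNIV. X $ n * rconst (rt D i (bas D n)))"

definition tderiv :: "ratfun ^ 'n \<Rightarrow> ratfun ^ 'n::finite" where
  "tderiv X = (\<chi> n. rderiv (X $ n))"

definition tscale :: "complex \<Rightarrow> ratfun ^ 'n \<Rightarrow> ratfun ^ 'n::finite" where
  "tscale c X = (\<chi> n. rscale c (X $ n))"

definition tres :: "('g::ab_group_add, 'n::finite, 'i) lie_data \<Rightarrow> complex \<Rightarrow> ratfun ^ 'n \<Rightarrow> 'g" where
  "tres D a X = (\<Sum>n\<in>UNIV. scl D (rres a (X $ n)) (bas D n))"

definition tres_inf :: "('g::ab_group_add, 'n::finite, 'i) lie_data \<Rightarrow> ratfun ^ 'n \<Rightarrow> 'g" where
  "tres_inf D X = (\<Sum>n\<in>UNIV. scl D (rres_inf (X $ n)) (bas D n))"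

text \<open>Action on one-forms: \<open>A(t) dt \<mapsto> \<upsilon>(A(\<omega>\<inverse> t)) \<omega>\<inverse> dt\<close>.\<close>

definition hat_form ::
  "('g::ab_group_add, 'n::finite, 'i) lie_data \<Rightarrow> complex \<Rightarrow> ('g \<Rightarrow> 'g) \<Rightarrow> ratfun ^ 'n \<Rightarrow> ratfun ^ 'n" where
  "hat_form D \<omega> \<upsilon> A = rconst (inverse \<omega>) *s tmap D \<upsilon> (tscale (inverse \<omega>) A)"

definition inv_forms ::
  "('g::ab_group_add, 'n::finite, 'i) lie_data \<Rightarrow> complex \<Rightarrow> ('g \<Rightarrow> 'g) \<Rightarrow> 'g set \<Rightarrow> (ratfun ^ 'n) set" where
  "inv_forms D \<omega> \<upsilon> S = {A \<in> tspace D S. hat_form D \<omega> \<upsilon> A = A}"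

text \<open>The adjoint group is a subgroup of the general linear group of \<open>'g\<close>, so its points over the
  field of rational functions are linear maps on \<open>ratfun ^ 'n\<close> (the adjoint action being
  application). For nilpotent \<open>ad X\<close> the exponential series is a finite sum.\<close>

definition texp ::
  "('g::ab_group_add, 'n::finite, 'i) lie_data \<Rightarrow> ratfun ^ 'n \<Rightarrow> ratfun ^ 'n \<Rightarrow> ratfun ^ 'n" where
  "texp D X Y = (\<Sum>j | (tbr D X ^^ j) Y \<noteq> 0. rconst (1 / fact j) *s (tbr D X ^^ j) Y)"

text \<open>The exponential map is an isomorphism of varieties from a nilpotent subalgebra onto the
  corresponding unipotent subgroup, hence surjective on points over any extension field.\<close>

definition unip ::
  "('g::ab_group_add, 'n::finite, 'i) lie_data \<Rightarrow> (ratfun ^ 'n \<Rightarrow> ratfun ^ 'n) set" where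
  "unip D = texp D ` tspace D (nil_plus D)"

text \<open>\<open>g(t) \<mapsto> \<upsilon> g(\<omega>\<inverse> t) \<upsilon>\<inverse>\<close>, the argument of \<open>g\<close> being rescaled by conjugation with
  \<open>tscale\<close>.\<close>

definition hat_group ::
  "('g::ab_group_add, 'n::finite, 'i) lie_data \<Rightarrow> complex \<Rightarrow> ('g \<Rightarrow> 'g) \<Rightarrow>
    (ratfun ^ 'n \<Rightarrow> ratfun ^ 'n) \<Rightarrow> ratfun ^ 'n \<Rightarrow> ratfun ^ 'n" where
  "hat_group D \<omega> \<upsilon> g =
     tmap D \<upsilon> \<circ> tscale (inverse \<omega>) \<circ> g \<circ> tscale \<omega> \<circ> tmap D (inv \<upsilon>)"

definition inv_unip ::
  "('g::ab_group_add, 'n::finite, 'i) lie_data \<Rightarrow> complex \<Rightarrow> ('g \<Rightarrow> 'g) \<Rightarrow>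
    (ratfun ^ 'n \<Rightarrow> ratfun ^ 'n) set" where
  "inv_unip D \<omega> \<upsilon> = {g \<in> unip D. hat_group D \<omega> \<upsilon> g = g}"


section \<open>Connections, opers and Miura opers\<close>

text \<open>The element \<open>dg g\<inverse>\<close>, identified through its adjoint action: \<open>ad (dg g\<inverse>) \<circ> g = dg\<close>, where the
  derivative of the operator \<open>g\<close> is its commutator with \<open>tderiv\<close>.\<close>

definition log_deriv ::
  "('g::ab_group_add, 'n::finite, 'i) lie_data \<Rightarrow> (ratfun ^ 'n \<Rightarrow> ratfun ^ 'n) \<Rightarrow> ratfun ^ 'n" where
  "log_deriv D g = (THE Y. \<forall>X. tbr D Y (g X) = tderiv (g X) - g (tderiv X))"

text \<open>The connection \<open>d + A dt\<close> is represented by \<open>A\<close>; gauge transformation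
  \<open>g (d + A dt) g\<inverse> = d - dg g\<inverse> + Ad\<^sub>g A dt\<close>.\<close>

definition gauge_act ::
  "('g::ab_group_add, 'n::finite, 'i) lie_data \<Rightarrow> (ratfun ^ 'n \<Rightarrow> ratfun ^ 'n) \<Rightarrow>
    ratfun ^ 'n \<Rightarrow> ratfun ^ 'n" where
  "gauge_act D g A = g A - log_deriv D g"

definition conn_bar ::
  "('g::ab_group_add, 'n::finite, 'i::finite) lie_data \<Rightarrow> ratfun ^ 'n \<Rightarrow> ratfun ^ 'n" where
  "conn_bar D A = A - tconst D (p_minus D)"

definition canonical_rep ::
  "('g::ab_group_add, 'n::finite, 'i::finite) lie_data \<Rightarrow> complex \<Rightarrow> ('g \<Rightarrow> 'g) \<Rightarrow>
    ratfun ^ 'n \<Rightarrow> ratfun ^ 'n \<Rightarrow> bool" where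
  "canonical_rep D \<omega> \<sigma> A c \<longleftrightarrow> c \<in> inv_forms D \<omega> \<sigma> (ker_ad_p_plus D) \<and>
     (\<exists>g\<in>inv_unip D \<omega> \<sigma>. gauge_act D g A = tconst D (p_minus D) + c)"

definition oper_regular_at ::
  "('g::ab_group_add, 'n::finite, 'i::finite) lie_data \<Rightarrow> complex \<Rightarrow> ('g \<Rightarrow> 'g) \<Rightarrow>
    ratfun ^ 'n \<Rightarrow> complex \<Rightarrow> bool" where
  "oper_regular_at D \<omega> \<sigma> A a \<longleftrightarrow> (\<exists>c. canonical_rep D \<omega> \<sigma> A c \<and> (\<forall>n. regular_at a (c $ n)))"

definition miura_opers ::
  "('g::ab_group_add, 'n::finite, 'i::finite) lie_data \<Rightarrow> complex \<Rightarrow> ('g \<Rightarrow> 'g) \<Rightarrow> (ratfun ^ 'n) set" where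
  "miura_opers D \<omega> \<nu> = {tconst D (p_minus D) + u | u. u \<in> inv_forms D \<omega> \<nu> (csa D)}"

end

theory Submission
  imports Defs
begin

text \<open>As the \<open>E\<^sub>i\<close> of the orbit commute, \<open>g\<close> is the exponential of \<open>X = \<Sum> f\<^sub>i E\<^sub>i\<close>, and by the
  Riccati equations \<open>g \<nabla> g\<inverse> = \<nabla> + \<Sum> f\<^sub>i \<alpha>\<^sub>i\<close> (with coroots \<open>\<alpha>\<^sub>i\<close>). Hence invariance of \<open>g\<close> and of
  the transformed oper both mean that \<open>f\<^sub>k\<close> coincides with \<open>\<omega>\<^sup>-\<^sup>q f\<^sub>k(\<omega>\<^sup>-\<^sup>q t)\<close>, where \<open>q\<close> is the
  length of the orbit. Both are solutions of the same Riccati equation, whose coefficient has the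
  residue \<open>- n\<close>, \<open>n = \<langle>\<alpha>\<^sub>k, \<lambda>\<^sub>0\<rangle>\<close>, at the origin. A solution regular at the origin vanishes there
  to order exactly \<open>n\<close>, and two such solutions agree iff their leading coefficients do, that is,
  iff \<open>\<omega>\<close> to the power \<open>q (n + 1)\<close> is \<open>1\<close>. A singular one has a simple pole with residue \<open>n + 1\<close> and
  is unique. The same leading term analysis at infinity gives the residue there.\<close>

section \<open>Rational functions\<close>

text \<open>The analysis takes place on two Laurent expansions, in \<open>t\<close> at the origin
  and in \<open>s = 1 / t\<close> at infinity. Rotating the one-form \<open>f dt\<close> by
  \<open>t \<mapsto> c t\<close> multiplies the coefficient of \<open>t^n\<close> by
  \<open>c^(n+1)\<close>; the extra \<open>1\<close> comes from \<open>dt\<close> and is what brings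
  \<open>rho\<close> into the congruence. The difference of two solutions obeys a linear equation,
  which forces its order at the origin. For regular solutions this order is \<open>n\<close>, so the
  leading coefficient is the only freedom; for singular ones it is \<open>- n - 2\<close>, too low
  for a difference of simple poles. At infinity a solution could also vanish to order two or more;
  this is what the sign condition in (3) excludes. On the Lie algebra side the obstacle is that a
  group element is given only as an operator, and \<open>dg g^(-1)\<close> only through its
  brackets. Both can be recovered since the center is trivial, also after extension of scalars, and
  since exponentials of root elements can be tested on \<open>rho\<close>.\<close>

lemma ratfun_cases:
  obtains p q where "q \<noteq> 0" "r = Fraction_Field.Fract p q" "quot_of_fract r = (p, q)" "coprime p q"
  by (metis Fract_quot_of_fract coprime_quot_of_fract snd_quot_of_fract_nonzero surjective_pairing)

text \<open>\<open>rderiv\<close>, \<open>rscale\<close> and \<open>rsubst\<close> are defined on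
  the normalized representative of a fraction. This cross-multiplied identity shows for each of them
  that every other representative gives the same value.\<close>

lemma quot_of_fract_FractE:
  assumes "q \<noteq> 0"
  obtains a b where "quot_of_fract (Fraction_Field.Fract p q) = (a, b)" "b \<noteq> 0" "p * b = a * q"
  by (metis assms eq_fract(1) ratfun_cases)

lemma rconst_simps [simp]: "rconst 0 = 0" "rconst 1 = 1"
  by (simp_all add: rconst_def Zero_fract_def One_fract_def pCons_one)

lemma rconst_add: "rconst (a + b) = rconst a + rconst b"
  by (simp add: rconst_def)

lemma rconst_mult: "rconst (a * b) = rconst a * rconst b"
  by (simp add: rconst_def mult.commute)

lemma rconst_eq_iff [simp]: "rconst a = rconst b \<longleftrightarrow> a = b"
  by (simp add: rconst_def eq_fract)

lemma rconst_eq_0_iff [simp]: "rconst a = 0 \<longleftrightarrow> a = 0"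
  using rconst_eq_iff[of a 0] by simp

lemma rconst_sum: "rconst (\<Sum>i\<in>A. h i) = (\<Sum>i\<in>A. rconst (h i))"
  by (induction A rule: infinite_finite_induct) (simp_all add: rconst_add)

lemma rderiv_Fract:
  assumes "q \<noteq> 0"
  shows "rderiv (Fraction_Field.Fract p q) =
    Fraction_Field.Fract (pderiv p * q - p * pderiv q) (q * q)"
proof -
  obtain a b where ab: "quot_of_fract (Fraction_Field.Fract p q) = (a, b)" "b \<noteq> 0" "p * b = a * q"
    using assms by (rule quot_of_fract_FractE)
  have d: "pderiv p * b + p * pderiv b = pderiv a * q + a * pderiv q"
    using arg_cong[OF ab(3), of pderiv] by (simp add: pderiv_mult algebra_simps)
  have "(pderiv a * b - a * pderiv b) * (q * q) = (pderiv p * q - p * pderiv q) * (b * b)"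
    using d ab(3) by algebra
  then show ?thesis
    using ab(1,2) assms by (simp add: rderiv_def eq_fract)
qed

lemma pcompose_linear_eq_0_iff: "c \<noteq> 0 \<Longrightarrow> pcompose q [:0, c:] = 0 \<longleftrightarrow> q = (0 :: complex poly)"
  by (simp add: pcompose_eq_0_iff)

lemma rscale_Fract:
  assumes "c \<noteq> 0" "q \<noteq> 0"
  shows "rscale c (Fraction_Field.Fract p q) =
    Fraction_Field.Fract (pcompose p [:0, c:]) (pcompose q [:0, c:])"
proof -
  obtain a b where ab: "quot_of_fract (Fraction_Field.Fract p q) = (a, b)" "b \<noteq> 0" "p * b = a * q"
    using assms(2) by (rule quot_of_fract_FractE)
  have "pcompose p [:0, c:] * pcompose b [:0, c:] = pcompose a [:0, c:] * pcompose q [:0, c:]"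
    using ab(3) by (metis pcompose_mult)
  then show ?thesis
    using ab(1,2) assms by (simp add: rscale_def eq_fract pcompose_linear_eq_0_iff)
qed

text \<open>No condition on \<open>c\<close> is imposed: the normalized denominator of a constant is
  \<open>1\<close>, which no substitution annihilates. Hence the direct computation of
  \<open>quot_of_fract\<close>.\<close>

lemma rscale_rconst [simp]: "rscale c (rconst a) = rconst a"
proof -
  have "quot_of_fract (rconst a) = ([:a:], 1)"
    using quot_of_fract_quot_to_fract'[of "([:a:], 1 :: complex poly)"]
    by (simp add: rconst_def quot_to_fract_def normalized_fracts_def)
  then show ?thesis
    by (simp add: rscale_def rconst_def pcompose_1)
qed

context
  fixes c :: complex
  assumes c: "c \<noteq> 0"
begin

lemma rscale_add: "rscale c (r + s) = rscale c r + rscale c s"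
proof -
  obtain p q p' q' where "q \<noteq> 0" "r = Fraction_Field.Fract p q"
    "q' \<noteq> 0" "s = Fraction_Field.Fract p' q'"
    by (metis ratfun_cases)
  then show ?thesis
    using c by (simp add: rscale_Fract pcompose_linear_eq_0_iff pcompose_mult pcompose_add)
qed

lemma rscale_mult: "rscale c (r * s) = rscale c r * rscale c s"
proof -
  obtain p q p' q' where "q \<noteq> 0" "r = Fraction_Field.Fract p q"
    "q' \<noteq> 0" "s = Fraction_Field.Fract p' q'"
    by (metis ratfun_cases)
  then show ?thesis
    using c by (simp add: rscale_Fract pcompose_linear_eq_0_iff pcompose_mult)
qed

lemma rscale_0 [simp]: "rscale c 0 = 0"
  using rscale_rconst[of c 0] by simp

lemma rscale_1 [simp]: "rscale c 1 = 1"
  using rscale_rconst[of c 1] by simp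

lemma rscale_power: "rscale c (r ^ n) = rscale c r ^ n"
  by (induction n) (simp_all add: rscale_mult)

lemma rderiv_rscale: "rderiv (rscale c r) = rconst c * rscale c (rderiv r)"
proof -
  obtain p q where pq: "q \<noteq> 0" "r = Fraction_Field.Fract p q"
    by (metis ratfun_cases)
  have d: "pderiv (pcompose a [:0, c:]) = pcompose (pderiv a) [:0, c:] * [:c:]" for a
    by (simp add: pderiv_pcompose pderiv_pCons)
  show ?thesis
    using c pq
    by (simp add: rscale_Fract rderiv_Fract pcompose_linear_eq_0_iff pcompose_mult pcompose_diff
        rconst_def d eq_fract algebra_simps)
qed

lemma rscale_rpole: "rscale c (rpole (c * b)) = rconst (inverse c) * rpole b"
proof -
  have "pcompose [:- (c * b), 1:] [:0, c:] = [:c:] * [:- b, 1:]"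
    by (simp add: pcompose_pCons)
  then show ?thesis
    using c by (simp add: rpole_def rconst_def rscale_Fract eq_fract pcompose_1 one_pCons)
qed

end

lemma rscale_rscale:
  assumes "b \<noteq> 0" "c \<noteq> 0"
  shows "rscale b (rscale c r) = rscale (b * c) r"
proof -
  obtain p q where pq: "q \<noteq> 0" "r = Fraction_Field.Fract p q"
    by (metis ratfun_cases)
  then show ?thesis
    using assms by (simp add: rscale_Fract pcompose_linear_eq_0_iff pcompose_pCons mult.commute
        flip: pcompose_assoc)
qed

lemma rscale_one [simp]: "rscale 1 r = r"
proof -
  obtain p q where pq: "q \<noteq> 0" "r = Fraction_Field.Fract p q"
    by (metis ratfun_cases)
  then show ?thesis
    by (simp add: rscale_Fract pcompose_idR)
qed

subsection \<open>Laurent expansions\<close>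

text \<open>No denominator vanishes at such an \<open>s\<close>, so that substitution is a
  well-defined field homomorphism into Laurent series.\<close>

definition transcendental :: "complex fls \<Rightarrow> bool" where
  "transcendental s \<longleftrightarrow> (\<forall>q. q \<noteq> 0 \<longrightarrow> poly (map_poly fls_const q) s \<noteq> 0)"

lemma map_poly_fls_const_add:
  "map_poly fls_const (p + q :: complex poly) = map_poly fls_const p + map_poly fls_const q"
  by (intro poly_eqI) (simp add: coeff_map_poly fls_plus_const)

lemma map_poly_fls_const_mult:
  "map_poly fls_const (p * q :: complex poly) = map_poly fls_const p * map_poly fls_const q"
proof (induction p)
  case (pCons a p)
  have "map_poly fls_const (smult a q) = smult (fls_const a) (map_poly fls_const q)"
    by (intro poly_eqI) (simp add: coeff_map_poly)
  with pCons show ?case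
    by (simp add: map_poly_pCons map_poly_fls_const_add)
qed simp

lemma rsubst_Fract:
  assumes "transcendental s" "q \<noteq> 0"
  shows "rsubst s (Fraction_Field.Fract p q) =
    poly (map_poly fls_const p) s / poly (map_poly fls_const q) s"
proof -
  obtain a b where ab: "quot_of_fract (Fraction_Field.Fract p q) = (a, b)" "b \<noteq> 0" "p * b = a * q"
    using assms(2) by (rule quot_of_fract_FractE)
  have "poly (map_poly fls_const p) s * poly (map_poly fls_const b) s =
    poly (map_poly fls_const a) s * poly (map_poly fls_const q) s"
    using ab(3) by (metis map_poly_fls_const_mult poly_mult)
  then show ?thesis
    using ab(1,2) assms by (simp add: rsubst_def transcendental_def frac_eq_eq)
qed

context
  fixes s :: "complex fls"
  assumes s: "transcendental s"
begin

lemma rsubst_add: "rsubst s (r + r') = rsubst s r + rsubst s r'"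
proof -
  obtain p q p' q' where "q \<noteq> 0" "r = Fraction_Field.Fract p q"
    "q' \<noteq> 0" "r' = Fraction_Field.Fract p' q'"
    by (metis ratfun_cases)
  moreover from this have "poly (map_poly fls_const q) s \<noteq> 0" "poly (map_poly fls_const q') s \<noteq> 0"
    using s by (auto simp: transcendental_def)
  ultimately show ?thesis
    using s by (simp add: rsubst_Fract map_poly_fls_const_add map_poly_fls_const_mult
        add_frac_eq)
qed

lemma rsubst_mult: "rsubst s (r * r') = rsubst s r * rsubst s r'"
proof -
  obtain p q p' q' where "q \<noteq> 0" "r = Fraction_Field.Fract p q"
    "q' \<noteq> 0" "r' = Fraction_Field.Fract p' q'"
    by (metis ratfun_cases)
  then show ?thesis
    using s by (simp add: rsubst_Fract map_poly_fls_const_mult)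
qed

lemma rsubst_rconst: "rsubst s (rconst a) = fls_const a"
  unfolding rconst_def using s by (simp add: rsubst_Fract map_poly_pCons)

lemma rsubst_0 [simp]: "rsubst s 0 = 0"
  using rsubst_rconst[of 0] by simp

lemma rsubst_1 [simp]: "rsubst s 1 = 1"
  using rsubst_rconst[of 1] by simp

lemma rsubst_minus: "rsubst s (- r) = - rsubst s r"
  by (metis add.right_inverse add_eq_0_iff rsubst_0 rsubst_add)

lemma rsubst_diff: "rsubst s (r - r') = rsubst s r - rsubst s r'"
  using rsubst_add[of r "- r'"] by (simp add: rsubst_minus)

text \<open>A homomorphism of fields is injective. This is what allows rules for
  \<open>rderiv\<close> and the equality of Riccati solutions to be proved on expansions.\<close>

lemma rsubst_eq_0_iff [simp]: "rsubst s r = 0 \<longleftrightarrow> r = 0"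
proof
  assume "rsubst s r = 0"
  then have "rsubst s r * rsubst s (inverse r) = 0" by simp
  then show "r = 0"
    by (metis right_inverse rsubst_1 rsubst_mult zero_neq_one)
qed simp

lemma rsubst_eq_iff [simp]: "rsubst s r = rsubst s r' \<longleftrightarrow> r = r'"
  by (metis eq_iff_diff_eq_0 rsubst_diff rsubst_eq_0_iff)

lemma rsubst_sum: "rsubst s (\<Sum>i\<in>A. h i) = (\<Sum>i\<in>A. rsubst s (h i))"
  by (induction A rule: infinite_finite_induct) (simp_all add: rsubst_add)

lemma rsubst_power: "rsubst s (r ^ n) = rsubst s r ^ n"
  by (induction n) (simp_all add: rsubst_mult)

lemma rsubst_rpole: "rsubst s (rpole b) = 1 / (s - fls_const b)"
proof -
  have "poly (map_poly fls_const [:- b, 1:]) s = s - fls_const b"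
    by (simp add: map_poly_pCons)
  then show ?thesis
    unfolding rpole_def using s by (simp add: rsubst_Fract)
qed

lemma fls_deriv_poly_map_poly_const:
  "fls_deriv (poly (map_poly fls_const p) s) = poly (map_poly fls_const (pderiv p)) s * fls_deriv s"
  by (induction p) (simp_all add: map_poly_pCons pderiv_pCons map_poly_fls_const_add algebra_simps)

text \<open>\<open>d\<close> stands for the derivative of \<open>p / q\<close>, which the product
  rule for \<open>p / q * q\<close> determines.\<close>

lemma quotient_rule_field:
  fixes q :: "'a :: field"
  assumes "q \<noteq> 0" "dp = p / q * dq + d * q"
  shows "d = (dp * q - p * dq) / (q * q)"
  using assms by (simp add: field_simps)

lemma fls_deriv_rsubst: "fls_deriv (rsubst s r) = rsubst s (rderiv r) * fls_deriv s"
proof -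
  obtain p q where pq: "q \<noteq> 0" "r = Fraction_Field.Fract p q"
    by (metis ratfun_cases)
  define P Q where "P = poly (map_poly fls_const p) s" and "Q = poly (map_poly fls_const q) s"
  have Q: "Q \<noteq> 0"
    using s pq by (auto simp: transcendental_def Q_def)
  have d: "map_poly fls_const (a - b) = map_poly fls_const a - map_poly fls_const b"
    for a b :: "complex poly"
    using map_poly_fls_const_add[of "a - b" b] by (simp add: algebra_simps)
  have "fls_deriv (P / Q * Q) = P / Q * fls_deriv Q + fls_deriv (P / Q) * Q"
    by (rule fls_deriv_mult)
  then have "fls_deriv P = P / Q * fls_deriv Q + fls_deriv (P / Q) * Q"
    by (simp only: nonzero_eq_divide_eq[OF Q, of "P / Q" P, THEN iffD1, OF refl])
  then have "fls_deriv (P / Q) = (fls_deriv P * Q - P * fls_deriv Q) / (Q * Q)"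
    by (rule quotient_rule_field[OF Q])
  moreover have "rsubst s (rderiv r) =
      (poly (map_poly fls_const (pderiv p)) s * Q - P * poly (map_poly fls_const (pderiv q)) s) / (Q * Q)"
    using s pq by (simp add: rsubst_Fract rderiv_Fract map_poly_fls_const_mult d P_def Q_def)
  moreover have "rsubst s r = P / Q"
    using s pq by (simp add: rsubst_Fract P_def Q_def)
  ultimately show ?thesis
    by (simp add: P_def Q_def fls_deriv_poly_map_poly_const algebra_simps)
qed

end

lemma fls_nth_X_times: "fls_nth (fls_X * F) n = fls_nth F (n - 1)" for F :: "complex fls"
  by (simp add: fls_X_times_conv_shift)

lemma fls_nth_X_inv_times: "fls_nth (fls_X_inv * F) n = fls_nth F (n + 1)" for F :: "complex fls"
  by (simp add: fls_X_inv_times_conv_shift)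

lemma fls_nth_poly_X:
  "fls_nth (poly (map_poly fls_const q) fls_X) n = (if n < 0 then 0 else coeff q (nat n))"
  for q :: "complex poly"
proof (induction q arbitrary: n)
  case (pCons a q)
  then show ?case
    by (auto simp: map_poly_pCons fls_nth_X_times coeff_pCons nat_diff_distrib split: nat.split)
qed simp

lemma fls_nth_poly_X_inv:
  "fls_nth (poly (map_poly fls_const q) fls_X_inv) n = (if n > 0 then 0 else coeff q (nat (- n)))"
  for q :: "complex poly"
proof (induction q arbitrary: n)
  case (pCons a q)
  then show ?case
    by (auto simp: map_poly_pCons fls_nth_X_inv_times coeff_pCons split: nat.split
        intro!: arg_cong[of _ _ "coeff q"])
qed simp

lemma transcendental_X: "transcendental fls_X"
  unfolding transcendental_def
proof (intro allI impI notI)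
  fix q :: "complex poly"
  assume q: "q \<noteq> 0" and "poly (map_poly fls_const q) fls_X = 0"
  then have "coeff q n = 0" for n
    using fls_nth_poly_X[of q "int n"] by simp
  with q show False
    by (auto intro: poly_eqI)
qed

lemma transcendental_X_inv: "transcendental fls_X_inv"
  unfolding transcendental_def
proof (intro allI impI notI)
  fix q :: "complex poly"
  assume q: "q \<noteq> 0" and "poly (map_poly fls_const q) fls_X_inv = 0"
  then have "coeff q n = 0" for n
    using fls_nth_poly_X_inv[of q "- int n"] by simp
  with q show False
    by (auto intro: poly_eqI)
qed

abbreviation at_zero :: "ratfun \<Rightarrow> complex fls" where
  "at_zero \<equiv> rsubst fls_X"

abbreviation at_inf :: "ratfun \<Rightarrow> complex fls" where
  "at_inf \<equiv> rsubst fls_X_inv"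

lemmas at_zero_simps = rsubst_add[OF transcendental_X] rsubst_mult[OF transcendental_X]
  rsubst_minus[OF transcendental_X] rsubst_diff[OF transcendental_X]
  rsubst_sum[OF transcendental_X] rsubst_power[OF transcendental_X]
  rsubst_rconst[OF transcendental_X] rsubst_rpole[OF transcendental_X]

lemmas at_inf_simps = rsubst_add[OF transcendental_X_inv] rsubst_mult[OF transcendental_X_inv]
  rsubst_minus[OF transcendental_X_inv] rsubst_diff[OF transcendental_X_inv]
  rsubst_sum[OF transcendental_X_inv] rsubst_power[OF transcendental_X_inv]
  rsubst_rconst[OF transcendental_X_inv] rsubst_rpole[OF transcendental_X_inv]

lemmas rsubst_eq_simps [simp] = rsubst_0[OF transcendental_X] rsubst_0[OF transcendental_X_inv]
  rsubst_1[OF transcendental_X] rsubst_1[OF transcendental_X_inv]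
  rsubst_eq_iff[OF transcendental_X] rsubst_eq_0_iff[OF transcendental_X]
  rsubst_eq_iff[OF transcendental_X_inv] rsubst_eq_0_iff[OF transcendental_X_inv]

lemma at_zero_rderiv: "at_zero (rderiv r) = fls_deriv (at_zero r)"
  by (simp add: fls_deriv_rsubst[OF transcendental_X])

text \<open>In the parameter \<open>s = 1 / t\<close> the derivation \<open>d/dt\<close> is
  \<open>- s^2 d/ds\<close>.\<close>

lemma at_inf_rderiv: "at_inf (rderiv r) = - (fls_X ^ 2) * fls_deriv (at_inf r)"
proof -
  have "fls_X * fls_X_inv = (1 :: complex fls)"
    by (intro fls_eqI) (simp add: fls_nth_X_times)
  then have "fls_X ^ 2 * fls_X_inv ^ 2 = (1 :: complex fls)"
    by (metis power_mult_distrib power_one)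
  then show ?thesis
    by (simp add: fls_deriv_rsubst[OF transcendental_X_inv] mult_ac)
qed

lemma rderiv_rconst [simp]: "rderiv (rconst a) = 0"
  unfolding rconst_def by (simp add: rderiv_Fract Zero_fract_def)

lemma rderiv_add: "rderiv (r + r') = rderiv r + rderiv r'"
  by (rule rsubst_eq_iff[OF transcendental_X, THEN iffD1]) (simp add: at_zero_simps at_zero_rderiv)

lemma rderiv_mult: "rderiv (r * r') = rderiv r * r' + r * rderiv r'"
  by (rule rsubst_eq_iff[OF transcendental_X, THEN iffD1])
    (simp add: at_zero_simps at_zero_rderiv algebra_simps)

lemma rderiv_0 [simp]: "rderiv 0 = 0"
  using rderiv_rconst[of 0] by simp

lemma rderiv_minus: "rderiv (- r) = - rderiv r"
  by (metis add.right_inverse add_eq_0_iff rderiv_0 rderiv_add)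

lemma rderiv_diff: "rderiv (r - r') = rderiv r - rderiv r'"
  using rderiv_add[of r "- r'"] by (simp add: rderiv_minus)

lemma rderiv_sum: "rderiv (\<Sum>i\<in>A. h i) = (\<Sum>i\<in>A. rderiv (h i))"
  by (induction A rule: infinite_finite_induct) (simp_all add: rderiv_add)

lemma at_zero_rscale:
  assumes c: "c \<noteq> 0"
  shows "at_zero (rscale c r) = fls_compose_fps (at_zero r) (fps_const c * fps_X)"
proof -
  obtain p q where pq: "q \<noteq> 0" "r = Fraction_Field.Fract p q"
    by (metis ratfun_cases)
  have H: "fps_const c * fps_X \<noteq> 0" "fps_nth (fps_const c * fps_X) 0 = 0"
    using c by simp_all
  have e: "poly (map_poly fls_const (pcompose a [:0, c:])) fls_X =
      fls_compose_fps (poly (map_poly fls_const a) fls_X) (fps_const c * fps_X)" for a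
    by (induction a) (use H in \<open>simp_all add: map_poly_pCons pcompose_pCons map_poly_fls_const_add
        map_poly_fls_const_mult fls_compose_fps_add fls_compose_fps_mult fls_times_fps_to_fls map_poly_smult\<close>)
  show ?thesis
    using c pq H e
    by (simp add: rscale_Fract rsubst_Fract[OF transcendental_X] pcompose_linear_eq_0_iff
        fls_compose_fps_divide)
qed

lemma at_zero_rscale_nth: "c \<noteq> 0 \<Longrightarrow> fls_nth (at_zero (rscale c r)) n = fls_nth (at_zero r) n * c powi n"
  by (simp add: at_zero_rscale fls_nth_fls_compose_fps_linear)

lemma rres_0: "rres 0 r = fls_nth (at_zero r) (- 1)"
  by (simp add: rres_def)

text \<open>The form \<open>dt = - ds / s^2\<close> accounts for the sign and for the exponent
  \<open>1\<close> in place of \<open>-1\<close>.\<close>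

lemma rres_inf: "rres_inf r = - fls_nth (at_inf r) 1"
  by (simp add: rres_inf_def fls_X_inv_power_times_conv_shift)

text \<open>For the converse, take \<open>r\<close> in lowest terms: if the denominator vanished at
  the origin, then so would the numerator, being the denominator times a series without
  pole.\<close>

lemma regular_at_0_iff: "regular_at 0 r \<longleftrightarrow> fls_subdegree (at_zero r) \<ge> 0"
proof
  assume "regular_at 0 r"
  then obtain p q where pq: "poly q 0 \<noteq> 0" "r = Fraction_Field.Fract p q"
    by (auto simp: regular_at_def)
  then have q: "q \<noteq> 0" by auto
  define P Q where "P = poly (map_poly fls_const p) fls_X" and "Q = poly (map_poly fls_const q) fls_X"
  have "fls_nth Q 0 \<noteq> 0"
    using fls_nth_poly_X[of q 0] pq by (simp add: Q_def poly_0_coeff_0)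
  then have Q: "fls_subdegree Q \<le> 0" "Q \<noteq> 0"
    by (auto intro: fls_subdegree_leI)
  have P: "fls_subdegree P \<ge> 0"
    unfolding P_def
    by (intro fls_subdegree_ge0I) (simp add: fls_nth_poly_X)
  have "at_zero r = P / Q"
    using q pq by (simp add: rsubst_Fract[OF transcendental_X] P_def Q_def)
  then show "fls_subdegree (at_zero r) \<ge> 0"
    using P Q by (cases "P = 0") (auto simp: fls_divide_subdegree)
next
  assume r: "fls_subdegree (at_zero r) \<ge> 0"
  obtain p q where pq: "q \<noteq> 0" "r = Fraction_Field.Fract p q" "coprime p q"
    by (metis ratfun_cases)
  define P Q where "P = poly (map_poly fls_const p) fls_X" and "Q = poly (map_poly fls_const q) fls_X"
  have rPQ: "at_zero r * Q = P"
    using pq transcendental_X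
    by (simp add: rsubst_Fract[OF transcendental_X] P_def Q_def transcendental_def)
  have Q: "fls_subdegree Q \<ge> 0"
    unfolding Q_def
    by (intro fls_subdegree_ge0I) (simp add: fls_nth_poly_X)
  have "poly q 0 \<noteq> 0"
  proof
    assume q0: "poly q 0 = 0"
    then have "fls_nth Q 0 = 0"
      using fls_nth_poly_X[of q 0] by (simp add: Q_def poly_0_coeff_0)
    moreover have "Q \<noteq> 0"
      using pq(1) transcendental_X by (simp add: Q_def transcendental_def)
    ultimately have "fls_subdegree Q \<noteq> 0"
      by (metis nth_fls_subdegree_nonzero)
    then have "0 < fls_subdegree (at_zero r) + fls_subdegree Q"
      using Q r by simp
    then have "fls_nth P 0 = 0"
      using rPQ fls_times_nth_eq0 by metis
    then have "poly p 0 = 0"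
      using fls_nth_poly_X[of p 0] by (simp add: P_def poly_0_coeff_0)
    then show False
      using q0 pq(3) by (metis coprime_poly_0)
  qed
  then show "regular_at 0 r"
    using pq(2) by (auto simp: regular_at_def)
qed

section \<open>Local analysis of the Riccati equation\<close>

text \<open>The bounds need not be the exact orders. This matters for the coefficient
  \<open>A\<close> of the equations below, which may vanish at its bound.\<close>

lemma fls_nth_mult_base:
  fixes F G :: "'a :: semiring_0 fls"
  assumes "\<And>k. k < m \<Longrightarrow> fls_nth F k = 0" "\<And>k. k < n \<Longrightarrow> fls_nth G k = 0"
  shows "fls_nth (F * G) (m + n) = fls_nth F m * fls_nth G n"
proof (cases "F = 0 \<or> G = 0")
  case False
  then have m: "m \<le> fls_subdegree F" and n: "n \<le> fls_subdegree G"
    using assms by (auto intro: fls_subdegree_geI)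
  show ?thesis
  proof (cases "m = fls_subdegree F \<and> n = fls_subdegree G")
    case True
    then show ?thesis
      by (simp add: fls_times_nth(1))
  next
    case False
    then have "m + n < fls_subdegree F + fls_subdegree G"
      using m n by linarith
    moreover have "fls_nth F m = 0 \<or> fls_nth G n = 0"
      using False m n by (metis fls_eq0_below_subdegree order_le_imp_less_or_eq)
    ultimately show ?thesis
      by (auto simp: fls_times_nth_eq0)
  qed
qed auto

text \<open>Comparison of lowest terms, with \<open>e\<close> the order of \<open>F\<close>. If
  \<open>e < -1\<close>, the square is alone in degree \<open>2 e\<close>. If \<open>e = -1\<close>,
  all three terms meet in degree \<open>-2\<close> and give \<open>r (r - 1 + b) = 0\<close>, where
  \<open>r\<close> and \<open>b\<close> are the coefficients of \<open>F\<close> and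
  \<open>A\<close> in degree \<open>-1\<close>. If \<open>e \<ge> 0\<close>, the square does not
  reach down to degree \<open>e - 1\<close>, and \<open>e + b\<close> must vanish.\<close>

lemma fls_riccati_at_zero:
  fixes F A :: "complex fls"
  assumes F: "F \<noteq> 0" and A: "\<And>k. k < -1 \<Longrightarrow> fls_nth A k = 0"
    and eq: "fls_deriv F + F ^ 2 + F * A = 0"
  shows "fls_subdegree F = -1 \<and> fls_nth F (-1) = 1 - fls_nth A (-1) \<or>
    fls_subdegree F \<ge> 0 \<and> of_int (fls_subdegree F) = - fls_nth A (-1)"
proof -
  define e where "e = fls_subdegree F"
  have e: "fls_nth F e \<noteq> 0" "\<And>k. k < e \<Longrightarrow> fls_nth F k = 0"
    using F by (auto simp: e_def)
  have FF: "fls_nth (F * F) (e + e) = fls_nth F e * fls_nth F e" "\<And>k. k < e + e \<Longrightarrow> fls_nth (F * F) k = 0"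
    by (rule fls_nth_mult_base[OF e(2) e(2)], assumption+) (simp add: e_def fls_times_nth_eq0)
  have FA: "fls_nth (F * A) (e - 1) = fls_nth F e * fls_nth A (-1)"
    using fls_nth_mult_base[OF e(2) A] by (simp add: diff_conv_add_uminus del: add_uminus_conv_diff)
  have FA0: "fls_nth (F * A) k = 0" if "k < e - 1" for k
  proof (cases "A = 0")
    case False
    then have "fls_subdegree A \<ge> -1"
      using A by (intro fls_subdegree_geI)
    then show ?thesis
      using that by (intro fls_times_nth_eq0) (simp add: e_def)
  qed simp
  have eqn: "of_int (n + 1) * fls_nth F (n + 1) + fls_nth (F * F) n + fls_nth (F * A) n = 0" for n
    using arg_cong[OF eq, of "\<lambda>X. fls_nth X n"] by (simp add: power2_eq_square)
  consider "e < -1" | "e = -1" | "e \<ge> 0" by linarith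
  then show ?thesis
  proof cases
    case 1
    then have "fls_nth F (e + e + 1) = 0" "fls_nth (F * A) (e + e) = 0"
      by (auto intro!: e FA0)
    then show ?thesis
      using eqn[of "e + e"] FF(1) e(1) by simp
  next
    case 2
    have "fls_nth F (-1) * (-1 + fls_nth F (-1) + fls_nth A (-1)) = 0"
      using eqn[of "-2"] FF(1) FA 2 by (simp add: algebra_simps)
    then have "-1 + fls_nth F (-1) + fls_nth A (-1) = 0"
      using e(1) 2 by simp
    then show ?thesis
      using 2 by (simp add: e_def[symmetric] algebra_simps) (metis add.commute add_diff_cancel)?
  next
    case 3
    then have "fls_nth (F * F) (e - 1) = 0"
      by (auto intro!: FF)
    then have "fls_nth F e * (of_int e + fls_nth A (-1)) = 0"
      using eqn[of "e - 1"] FA by (simp add: algebra_simps)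
    then have "of_int e + fls_nth A (-1) = 0"
      using e(1) by simp
    then show ?thesis
      using 3 by (simp add: e_def[symmetric] add_eq_0_iff)
  qed
qed

text \<open>\<open>A\<close> is the logarithmic derivative of \<open>F\<close>, and the residue of a
  logarithmic derivative is the order.\<close>

lemma fls_linear_ode_at_zero:
  fixes F A :: "complex fls"
  assumes F: "F \<noteq> 0" and A: "\<And>k. k < -1 \<Longrightarrow> fls_nth A k = 0" and eq: "fls_deriv F = A * F"
  shows "of_int (fls_subdegree F) = fls_nth A (-1)"
proof -
  define e where "e = fls_subdegree F"
  have e: "fls_nth F e \<noteq> 0" "\<And>k. k < e \<Longrightarrow> fls_nth F k = 0"
    using F by (auto simp: e_def)
  have "fls_nth (A * F) (e - 1) = fls_nth A (-1) * fls_nth F e"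
    using fls_nth_mult_base[OF A e(2), of "-1" e] by (simp add: add.commute)
  moreover have "fls_nth (fls_deriv F) (e - 1) = of_int e * fls_nth F e"
    by simp
  ultimately show ?thesis
    using e(1) eq by (simp add: e_def[symmetric])
qed

text \<open>Because of the factor \<open>fls_X ^ 2\<close> the three terms now balance at order
  \<open>1\<close>. A smaller order leaves the square without counterpart. A larger order
  \<open>e\<close> would force \<open>fls_nth A 1 = e\<close>, so that \<open>pos\<close> would make
  \<open>1 - e\<close> non-negative.\<close>

lemma fls_riccati_at_infinity:
  fixes F A :: "complex fls"
  assumes F: "F \<noteq> 0" and A: "\<And>k. k < 1 \<Longrightarrow> fls_nth A k = 0"
    and eq: "- (fls_X ^ 2) * fls_deriv F + F ^ 2 + F * A = 0"
    and pos: "1 - fls_nth A 1 \<in> \<real>\<^sub>\<ge>\<^sub>0"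
  shows "fls_nth F 1 = 1 - fls_nth A 1"
proof -
  define e where "e = fls_subdegree F"
  have e: "fls_nth F e \<noteq> 0" "\<And>k. k < e \<Longrightarrow> fls_nth F k = 0"
    using F by (auto simp: e_def)
  have FF: "fls_nth (F * F) (e + e) = fls_nth F e * fls_nth F e" "\<And>k. k < e + e \<Longrightarrow> fls_nth (F * F) k = 0"
    by (rule fls_nth_mult_base[OF e(2) e(2)], assumption+) (simp add: e_def fls_times_nth_eq0)
  have FA: "fls_nth (F * A) (e + 1) = fls_nth F e * fls_nth A 1"
    using fls_nth_mult_base[OF e(2) A] by simp
  have FA0: "fls_nth (F * A) k = 0" if "k < e + 1" for k
  proof (cases "A = 0")
    case False
    then have "fls_subdegree A \<ge> 1"
      using A by (intro fls_subdegree_geI)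
    then show ?thesis
      using that by (intro fls_times_nth_eq0) (simp add: e_def)
  qed simp
  have eqn: "- (of_int (n - 1) * fls_nth F (n - 1)) + fls_nth (F * F) n + fls_nth (F * A) n = 0" for n
    using arg_cong[OF eq, of "\<lambda>X. fls_nth X n"]
    by (simp add: power2_eq_square fls_nth_X_times mult.assoc)
  consider "e < 1" | "e = 1" | "e > 1" by linarith
  then show ?thesis
  proof cases
    case 1
    then have "fls_nth F (e + e - 1) = 0" "fls_nth (F * A) (e + e) = 0"
      by (auto intro!: e FA0)
    then show ?thesis
      using eqn[of "e + e"] FF(1) e(1) by simp
  next
    case 2
    have "fls_nth F 1 * (-1 + fls_nth F 1 + fls_nth A 1) = 0"
      using eqn[of 2] FF(1) FA 2 by (simp add: algebra_simps)
    then have "-1 + fls_nth F 1 + fls_nth A 1 = 0"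
      using e(1) 2 by simp
    then show ?thesis
      by (simp add: algebra_simps)
  next
    case 3
    then have "fls_nth (F * F) (e + 1) = 0"
      by (auto intro!: FF)
    then have "fls_nth F e * (- of_int e + fls_nth A 1) = 0"
      using eqn[of "e + 1"] FA by (auto simp: algebra_simps)
    then have "fls_nth A 1 = of_int e"
      using e(1) by simp
    then have "1 - of_int e \<ge> (0::real)"
      using pos by (auto simp: complex_nonneg_Reals_iff)
    then show ?thesis
      using 3 by simp
  qed
qed

text \<open>The coefficient of the pullback of \<open>r dt\<close> under
  \<open>t \<mapsto> c t\<close>.\<close>

definition twist :: "complex \<Rightarrow> ratfun \<Rightarrow> ratfun" where
  "twist c r = rconst c * rscale c r"

lemma twist_twist: "b \<noteq> 0 \<Longrightarrow> c \<noteq> 0 \<Longrightarrow> twist b (twist c r) = twist (b * c) r"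
  by (simp add: twist_def rscale_mult rscale_rscale rconst_mult)

lemma twist_one [simp]: "twist 1 r = r"
  by (simp add: twist_def)

lemma twist_funpow: "c \<noteq> 0 \<Longrightarrow> (twist c ^^ n) r = twist (c ^ n) r"
  by (induction n) (simp_all add: twist_twist)

lemma twist_eq_0_iff [simp]: "c \<noteq> 0 \<Longrightarrow> twist c r = 0 \<longleftrightarrow> r = 0"
  using twist_twist[of "inverse c" c r] by (auto simp: twist_def)

text \<open>All three terms transform like coefficients of \<open>(dt)^2\<close>, so the left-hand
  side as a whole is rescaled and multiplied by \<open>c^2\<close>.\<close>

lemma twist_riccati:
  assumes "c \<noteq> 0" "rderiv f + f\<^sup>2 + f * a = 0"
  shows "rderiv (twist c f) + (twist c f)\<^sup>2 + twist c f * twist c a = 0"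
proof -
  have "rderiv (twist c f) + (twist c f)\<^sup>2 + twist c f * twist c a =
      rconst (c ^ 2) * rscale c (rderiv f + f\<^sup>2 + f * a)"
    using assms(1) by (simp add: twist_def rderiv_mult rderiv_rscale rscale_add rscale_mult
        rscale_power rconst_mult power2_eq_square algebra_simps)
  then show ?thesis
    using assms by simp
qed

text \<open>Residues are thus unchanged, the factor being \<open>1\<close> at \<open>n = -1\<close>;
  this explains the \<open>2\<close> in \<open>riccati_twist_order\<close> below.\<close>

lemma at_zero_twist_nth:
  assumes "c \<noteq> 0"
  shows "fls_nth (at_zero (twist c r)) n = fls_nth (at_zero r) n * c powi (n + 1)"
  using assms by (simp add: twist_def at_zero_simps at_zero_rscale_nth power_int_add)

lemma regular_at_0_twist_iff: "c \<noteq> 0 \<Longrightarrow> regular_at 0 (twist c r) \<longleftrightarrow> regular_at 0 r"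
proof (cases "r = 0")
  case False
  assume c: "c \<noteq> 0"
  have "fls_subdegree (at_zero (twist c r)) = fls_subdegree (at_zero r)"
    using c False by (intro fls_subdegree_eqI) (simp_all add: at_zero_twist_nth)
  then show ?thesis
    by (simp add: regular_at_0_iff)
qed (simp add: twist_def)

lemma rres_0_regular: "regular_at 0 r \<Longrightarrow> rres 0 r = 0"
  by (simp add: rres_0 regular_at_0_iff)

context
  fixes f a :: ratfun
  assumes f: "f \<noteq> 0" and riccati: "rderiv f + f\<^sup>2 + f * a = 0"
    and a: "\<And>n. n < -1 \<Longrightarrow> fls_nth (at_zero a) n = 0"
begin

lemma riccati_at_zero:
  "fls_subdegree (at_zero f) = -1 \<and> rres 0 f = 1 - rres 0 a \<or>
    fls_subdegree (at_zero f) \<ge> 0 \<and> of_int (fls_subdegree (at_zero f)) = - rres 0 a"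
proof -
  have "fls_deriv (at_zero f) + (at_zero f)\<^sup>2 + at_zero f * at_zero a = 0"
    using arg_cong[OF riccati, of at_zero] by (simp add: at_zero_simps at_zero_rderiv)
  then show ?thesis
    using fls_riccati_at_zero[of "at_zero f" "at_zero a"] f a by (simp add: rres_0)
qed

text \<open>The difference \<open>d\<close> of two solutions satisfies \<open>d' = - (f + g + a) d\<close>, which determines its
  order of vanishing at the origin.\<close>

lemma riccati_twist_order:
  assumes c: "c \<noteq> 0" and inv: "twist c a = a" and ne: "twist c f \<noteq> f"
  shows "of_int (fls_subdegree (at_zero (twist c f - f))) = - 2 * rres 0 f - rres 0 a"
proof -
  let ?F = "at_zero f" and ?G = "at_zero (twist c f)" and ?A = "at_zero a"
  have "rderiv (twist c f) + (twist c f)\<^sup>2 + twist c f * a = 0"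
    using twist_riccati[OF c riccati] inv by simp
  then have "rderiv (twist c f - f) = - (twist c f + f + a) * (twist c f - f)"
    using riccati by (simp add: rderiv_diff) algebra
  then have "fls_deriv (at_zero (twist c f - f)) = at_zero (- (twist c f + f + a)) * at_zero (twist c f - f)"
    using transcendental_X by (metis at_zero_rderiv rsubst_mult)
  moreover have "fls_nth (at_zero (- (twist c f + f + a))) n = 0" if "n < -1" for n
    using that riccati_at_zero c a by (auto simp: at_zero_simps at_zero_twist_nth)
  ultimately have "of_int (fls_subdegree (at_zero (twist c f - f))) =
      fls_nth (at_zero (- (twist c f + f + a))) (-1)"
    using ne by (intro fls_linear_ode_at_zero) auto
  then show ?thesis
    using c by (simp add: at_zero_simps at_zero_twist_nth rres_0)
qed

text \<open>A regular \<open>f\<close> has residue zero, so a non-zero difference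
  \<open>twist c f - f\<close> has order \<open>- rres 0 a\<close>, which is the order of
  \<open>f\<close> itself. There its coefficient is the leading coefficient of \<open>f\<close>
  times the discrepancy of \<open>c powi (e + 1)\<close> from \<open>1\<close>.\<close>

lemma riccati_twist_iff:
  assumes c: "c \<noteq> 0" and inv: "twist c a = a" and reg: "regular_at 0 f"
  shows "twist c f = f \<longleftrightarrow> c powi (fls_subdegree (at_zero f) + 1) = 1"
proof -
  let ?e = "fls_subdegree (at_zero f)"
  have e: "of_int ?e = - rres 0 a" "fls_nth (at_zero f) ?e \<noteq> 0"
    using riccati_at_zero reg f by (auto simp: regular_at_0_iff)
  have d: "fls_nth (at_zero (twist c f - f)) ?e = fls_nth (at_zero f) ?e * (c powi (?e + 1) - 1)"
    using c by (simp add: at_zero_simps at_zero_twist_nth algebra_simps)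
  show ?thesis
  proof
    assume "twist c f = f"
    then show "c powi (?e + 1) = 1"
      using d e by simp
  next
    assume "c powi (?e + 1) = 1"
    then have 0: "fls_nth (at_zero (twist c f - f)) ?e = 0"
      using d by simp
    show "twist c f = f"
    proof (rule ccontr)
      assume ne: "twist c f \<noteq> f"
      then have "of_int (fls_subdegree (at_zero (twist c f - f))) = (of_int ?e :: complex)"
        using riccati_twist_order[OF c inv ne] e reg by (simp add: rres_0_regular)
      then have "fls_subdegree (at_zero (twist c f - f)) = ?e"
        using of_int_eq_iff by blast
      with 0 ne show False
        by (metis nth_fls_subdegree_zero_iff rsubst_eq_0_iff transcendental_X right_minus_eq)
    qed
  qed
qed

text \<open>Inserting the residue \<open>1 - rres 0 a\<close> of \<open>f\<close>, a non-zero
  difference would have order \<open>rres 0 a - 2\<close>, at most \<open>-2\<close>; but both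
  solutions have only simple poles.\<close>

lemma riccati_twist_singular:
  assumes c: "c \<noteq> 0" and inv: "twist c a = a" and sing: "\<not> regular_at 0 f"
    and pos: "- rres 0 a \<in> \<real>\<^sub>\<ge>\<^sub>0"
  shows "twist c f = f"
proof (rule ccontr)
  assume ne: "twist c f \<noteq> f"
  let ?d = "fls_subdegree (at_zero (twist c f - f))"
  have res: "fls_subdegree (at_zero f) = -1" "rres 0 f = 1 - rres 0 a"
    using riccati_at_zero sing by (auto simp: regular_at_0_iff)
  then have "of_int ?d = -2 + rres 0 a"
    using riccati_twist_order[OF c inv ne] by simp
  then have "real_of_int ?d = -2 + Re (rres 0 a)"
    by (auto simp: complex_eq_iff)
  moreover have "Re (rres 0 a) \<le> 0"
    using pos by (simp add: complex_nonneg_Reals_iff)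
  ultimately have "?d < -1"
    by linarith
  then have "fls_nth (at_zero (twist c f - f)) ?d = 0"
    using res c by (simp add: at_zero_simps at_zero_twist_nth)
  with ne show False
    by (metis nth_fls_subdegree_zero_iff rsubst_eq_0_iff transcendental_X right_minus_eq)
qed

end

lemma riccati_at_infinity:
  assumes f: "f \<noteq> 0" and riccati: "rderiv f + f\<^sup>2 + f * a = 0"
    and a: "\<And>n. n < 1 \<Longrightarrow> fls_nth (at_inf a) n = 0" and pos: "rres_inf a + 1 \<in> \<real>\<^sub>\<ge>\<^sub>0"
  shows "rres_inf f = - (rres_inf a + 1)"
proof -
  have "- (fls_X ^ 2) * fls_deriv (at_inf f) + (at_inf f)\<^sup>2 + at_inf f * at_inf a = 0"
    using arg_cong[OF riccati, of at_inf] by (simp add: at_inf_simps at_inf_rderiv)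
  then show ?thesis
    using fls_riccati_at_infinity[of "at_inf f" "at_inf a"] f a pos
    by (simp add: rres_inf add.commute)
qed

lemma at_zero_rpole_nth: "b \<noteq> 0 \<Longrightarrow> n < 0 \<Longrightarrow> fls_nth (at_zero (rpole b)) n = 0"
proof -
  assume b: "b \<noteq> 0" and n: "n < 0"
  have "regular_at 0 (rpole b)"
    unfolding regular_at_def rpole_def using b by (intro exI[of _ "[:- b, 1:]"] exI[of _ 1]) simp
  then show ?thesis
    using n by (simp add: regular_at_0_iff)
qed

lemma at_zero_rpole_0: "at_zero (rpole 0) = fls_X_inv"
  by (simp add: at_zero_simps inverse_eq_divide[symmetric] fls_inverse_X fls_X_inv_conv_shift_1)

lemma at_inf_rpole_nth: "n < 1 \<Longrightarrow> fls_nth (at_inf (rpole b)) n = 0"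
proof -
  assume n: "n < 1"
  have "fls_subdegree (fls_X_inv - fls_const b) = -1"
    by (rule fls_subdegree_eqI) auto
  moreover from this have "fls_X_inv - fls_const b \<noteq> 0"
    by auto
  ultimately have "fls_subdegree (at_inf (rpole b)) = 1"
    by (simp add: at_inf_simps fls_divide_subdegree)
  then show ?thesis
    using n by simp
qed

section \<open>Lie algebras\<close>

context lie_algebra
begin

sublocale V: vector_space "scl D"
  by (rule vector_space)

lemma br_0_left [simp]: "br D 0 y = 0"
  using br_add_left[of 0 0 y] by simp

lemma br_0_right [simp]: "br D x 0 = 0"
  using br_add_right[of x 0 0] by simp

lemma br_minus_left: "br D (- x) y = - br D x y"
  using br_add_left[of x "- x" y] by (simp add: add_eq_0_iff)

lemma br_minus_right: "br D x (- y) = - br D x y"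
  using br_add_right[of x y "- y"] by (simp add: add_eq_0_iff)

lemma br_diff_left: "br D (x - x') y = br D x y - br D x' y"
  using br_add_left[of x "- x'" y] by (simp add: br_minus_left)

lemma br_anticommute: "br D x y = - br D y x"
proof -
  have "br D (x + y) (x + y) = br D x x + br D x y + (br D y x + br D y y)"
    by (simp add: br_add_left br_add_right)
  then show ?thesis
    by (simp add: br_self eq_neg_iff_add_eq_0)
qed

lemma br_derivation: "br D x (br D y z) = br D (br D x y) z + br D y (br D x z)"
  using jacobi[of x y z] br_anticommute[of z "br D x y"] br_anticommute[of z x]
  by (simp add: br_minus_right algebra_simps add_eq_0_iff)

lemma lie_generated_minimal: "lie_subalgebra D S \<Longrightarrow> X \<subseteq> S \<Longrightarrow> lie_generated D X \<subseteq> S"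
  unfolding lie_generated_def by blast

lemma lie_generated_incl: "X \<subseteq> lie_generated D X"
  unfolding lie_generated_def by blast

lemma lie_subalgebra_centralizer: "lie_subalgebra D {y. br D x y = 0}"
  by (auto simp: lie_subalgebra_def V.subspace_def br_add_right br_scl_right br_derivation)

end

context semisimple_lie_data
begin

text \<open>The center is an abelian ideal, hence solvable. It follows that elements are determined
  by their brackets.\<close>

lemma center_trivial:
  assumes "\<And>y. br D x y = 0"
  shows "x = 0"
proof -
  let ?Z = "{x. \<forall>y. br D x y = 0}"
  have "br D y x = 0" if "x \<in> ?Z" for x y
    using that br_anticommute[of y x] by simp
  then have "lie_ideal D ?Z"
    by (auto simp: lie_ideal_def V.subspace_def br_add_left br_scl_left)
  moreover have "br_span D ?Z ?Z = {0}"
  proof -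
    have "{br D a b | a b. a \<in> ?Z \<and> b \<in> ?Z} = {0}"
      by (auto intro!: exI[of _ 0])
    then show ?thesis
      by (simp add: br_span_def)
  qed
  then have "lie_solvable D ?Z"
    unfolding lie_solvable_def by (intro exI[of _ 1]) simp
  ultimately have "?Z = {0}"
    using semisimple by (simp add: semisimple_def)
  with assms show ?thesis
    by blast
qed

lemma csa_subalgebra: "lie_subalgebra D (csa D)"
  using cartan by (simp add: cartan_subalgebra_def)

lemma csa_subspace: "V.subspace (csa D)"
  using csa_subalgebra by (simp add: lie_subalgebra_def)

lemmas csa_closed = V.subspace_0[OF csa_subspace] V.subspace_add[OF csa_subspace]
  V.subspace_diff[OF csa_subspace] V.subspace_neg[OF csa_subspace] V.subspace_scale[OF csa_subspace]

lemma br_E: "x \<in> csa D \<Longrightarrow> br D x (genE D i) = scl D (rt D i x) (genE D i)"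
  and br_F: "x \<in> csa D \<Longrightarrow> br D x (genF D i) = scl D (- rt D i x) (genF D i)"
  and coroot_in_csa: "coroot D i \<in> csa D"
  and rt_coroot: "rt D i (coroot D i) = 2"
  and br_EF: "br D (genE D i) (genF D j) = (if i = j then coroot D i else 0)"
  using chevalley_serre by (auto simp: chevalley_serre_def root_space_def cartan_matrix_def)

lemma generated: "lie_generated D (range (genE D) \<union> range (coroot D) \<union> range (genF D)) = UNIV"
  using chevalley_serre by (simp add: chevalley_serre_def)

lemma serre_E:
  assumes "i \<noteq> j"
  obtains n where "cartan_matrix D i j = - of_nat n" "(br D (genE D i) ^^ (n + 1)) (genE D j) = 0"
  using chevalley_serre[unfolded chevalley_serre_def, THEN conjunct2, THEN conjunct2, THEN conjunct1] assms
  by blast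

lemma linear_rt: "Vector_Spaces.linear (scl D) (*) (rt D i)"
  using simple_roots by (simp add: simple_roots_def is_root_def)

lemma rt_add: "rt D i (x + y) = rt D i x + rt D i y"
  and rt_scl: "rt D i (scl D c x) = c * rt D i x"
  using linear_rt[of i] by (auto simp: Vector_Spaces.linear_iff)

lemma rt_0 [simp]: "rt D i 0 = 0"
  using rt_add[of i 0 0] by simp

lemma rt_minus: "rt D i (- x) = - rt D i x"
  using rt_add[of i x "- x"] by (simp add: add_eq_0_iff)

lemma rt_diff: "rt D i (x - y) = rt D i x - rt D i y"
  using rt_add[of i x "- y"] by (simp add: rt_minus)

lemma rt_sum: "rt D i (\<Sum>j\<in>A. h j) = (\<Sum>j\<in>A. rt D i (h j))"
  by (induction A rule: infinite_finite_induct) (simp_all add: rt_add)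

text \<open>The centralizer of \<open>x\<close> is a subalgebra, and it contains the coroots because
  they are brackets of the \<open>genE\<close> and \<open>genF\<close>. So \<open>x\<close> is
  central.\<close>

lemma eq_0_if_commutes_with_generators:
  assumes "\<And>i. br D x (genE D i) = 0" "\<And>i. br D x (genF D i) = 0"
  shows "x = 0"
proof (rule center_trivial)
  have "br D x (coroot D i) = 0" for i
    using assms br_derivation[of x "genE D i" "genF D i"] by (simp add: br_EF)
  then have "range (genE D) \<union> range (coroot D) \<union> range (genF D) \<subseteq> {y. br D x y = 0}"
    using assms by auto
  then show "br D x y = 0" for y
    using lie_generated_minimal[OF lie_subalgebra_centralizer] generated by blast
qed

text \<open>Together with \<open>ex_csa_rt\<close> this makes the simple roots coordinates on the
  Cartan subalgebra.\<close>

lemma csa_eq_0_if_rt_eq_0: "x \<in> csa D \<Longrightarrow> (\<And>i. rt D i x = 0) \<Longrightarrow> x = 0"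
  by (rule eq_0_if_commutes_with_generators) (simp_all add: br_E br_F)

text \<open>If the linear map \<open>x \<mapsto> (\<alpha>\<^sub>i x)\<^sub>i\<close> were not onto, its range would lie in a hyperplane, that
  is, the simple roots would be linearly dependent.\<close>

lemma ex_csa_rt:
  fixes c :: "'c \<Rightarrow> complex"
  shows "\<exists>x\<in>csa D. \<forall>i. rt D i x = c i"
proof -
  let ?R = "(\<lambda>x. (\<chi> i. rt D i x) :: complex ^ 'c) ` csa D"
  have sub: "subspace ?R"
    unfolding subspace_def
  proof (intro conjI ballI allI)
    show "0 \<in> ?R"
      using csa_closed by (intro image_eqI[of _ _ 0]) (simp_all add: vec_eq_iff)
    fix v w assume "v \<in> ?R" "w \<in> ?R"
    then obtain x y where "x \<in> csa D" "y \<in> csa D" "v = (\<chi> i. rt D i x)" "w = (\<chi> i. rt D i y)"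
      by auto
    then show "v + w \<in> ?R"
      using csa_closed by (intro image_eqI[of _ _ "x + y"]) (simp_all add: vec_eq_iff rt_add)
  next
    fix r :: real and v assume "v \<in> ?R"
    then obtain x where "x \<in> csa D" "v = (\<chi> i. rt D i x)"
      by auto
    then show "r *\<^sub>R v \<in> ?R"
      using csa_closed
      by (intro image_eqI[of _ _ "scl D (of_real r) x"]) (simp_all add: vec_eq_iff rt_scl flip: scaleR_conv_of_real)
  qed
  have "?R = UNIV"
  proof (rule ccontr)
    assume "?R \<noteq> UNIV"
    then obtain a :: "complex ^ 'c" where a: "a \<noteq> 0" "?R \<subseteq> {v. a \<bullet> v = 0}"
      using span_not_univ_subset_hyperplane[of ?R] sub by (auto simp: span_eq_iff[THEN iffD2])
    \<comment> \<open>The hyperplane is a real one, for the real inner product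
      \<open>Re (cnj a z)\<close>; hence the conjugates. As the range is stable under complex
      multiples, testing \<open>z = 1\<close> and \<open>z = \<i>\<close> kills the real and the
      imaginary part.\<close>
    have zero: "(\<Sum>i\<in>UNIV. cnj (a $ i) * rt D i x) = 0" if x: "x \<in> csa D" for x
    proof -
      let ?s = "\<Sum>i\<in>UNIV. cnj (a $ i) * rt D i x"
      have *: "a \<bullet> (\<chi> i. z * rt D i x) = Re (z * ?s)" for z
        by (simp add: inner_vec_def inner_complex_def sum_distrib_left sum_subtractf sum.distrib
            algebra_simps)
      have "(\<chi> i. z * rt D i x) \<in> ?R" for z
        using x csa_closed by (intro image_eqI[of _ _ "scl D z x"]) (simp_all add: vec_eq_iff rt_scl)
      then have "Re (z * ?s) = 0" for z
        using a(2) * by fastforce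
      from this[of 1] this[of \<i>] show ?thesis
        by (simp add: complex_eq_iff)
    qed
    have "\<forall>i. c i = 0" if "\<forall>x\<in>csa D. (\<Sum>i\<in>UNIV. c i * rt D i x) = 0" for c
      using simple_roots[unfolded simple_roots_def, THEN conjunct2, THEN conjunct1, THEN spec, of c] that
      by (rule mp)
    from this[of "\<lambda>i. cnj (a $ i)"] have "\<forall>i. cnj (a $ i) = 0"
      using zero by simp
    with a(1) show False
      by (simp add: vec_eq_iff)
  qed
  then have "(\<chi> i. c i) \<in> ?R"
    by simp
  then show ?thesis
    by (auto simp: vec_eq_iff)
qed

lemma rho_in_csa: "rho D \<in> csa D" and rt_rho: "rt D i (rho D) = 1"
proof -
  have "\<exists>!x. x \<in> csa D \<and> (\<forall>i. rt D i x = 1)"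
  proof (rule ex_ex1I)
    show "\<exists>x. x \<in> csa D \<and> (\<forall>i. rt D i x = 1)"
      using ex_csa_rt[of "\<lambda>_. 1"] by blast
    fix x y assume "x \<in> csa D \<and> (\<forall>i. rt D i x = 1)" "y \<in> csa D \<and> (\<forall>i. rt D i y = 1)"
    then show "x = y"
      using csa_eq_0_if_rt_eq_0[of "x - y"] by (simp add: csa_closed rt_diff)
  qed
  from theI'[OF this] show "rho D \<in> csa D" "rt D i (rho D) = 1"
    unfolding rho_def by auto
qed

lemma simple_refl_csa: "x \<in> csa D \<Longrightarrow> simple_refl D i x \<in> csa D"
  by (simp add: simple_refl_def csa_closed coroot_in_csa)

lemma weyl_csa: "w \<in> weyl D \<Longrightarrow> x \<in> csa D \<Longrightarrow> w x \<in> csa D"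
  by (induction rule: weyl.induct) (simp_all add: simple_refl_csa)

lemma weyl_dot_csa: "w \<in> weyl D \<Longrightarrow> x \<in> csa D \<Longrightarrow> weyl_dot D w x \<in> csa D"
  by (simp add: weyl_dot_def csa_closed weyl_csa rho_in_csa)

text \<open>The coroots involved are orthogonal, so no reflection changes the pairing that the next
  one uses. The \<open>1\<close> is the pairing with \<open>rho D\<close>.\<close>

lemma weyl_dot_comp_prod_simple_refl:
  assumes "distinct is" "\<And>i j. i \<in> set is \<Longrightarrow> j \<in> set is \<Longrightarrow> i \<noteq> j \<Longrightarrow> cartan_matrix D i j = 0"
  shows "weyl_dot D (comp_prod (simple_refl D) is) x =
    x - (\<Sum>i\<in>set is. scl D (rt D i x + 1) (coroot D i))"
proof -
  have "comp_prod (simple_refl D) is y = y - (\<Sum>i\<in>set is. scl D (rt D i y) (coroot D i))" for y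
    using assms
  proof (induction "is")
    case (Cons i "is")
    have "rt D i (coroot D j) = 0" if "j \<in> set is" for j
      using Cons.prems that by (auto simp: cartan_matrix_def)
    then show ?case
      using Cons by (simp add: comp_prod_def simple_refl_def rt_diff rt_sum rt_scl)
  qed (simp add: comp_prod_def)
  then show ?thesis
    by (simp add: weyl_dot_def rt_add rt_rho)
qed

section \<open>The automorphism attached to the diagram automorphism\<close>

context
  fixes \<nu> :: "'c \<Rightarrow> 'c" and \<phi> :: "'a \<Rightarrow> 'a"
  assumes \<phi>: "twisted_automorphism D \<nu> 1 \<phi>" and \<nu>: "bij \<nu>"
begin

lemma automorphism_linear: "\<phi> (x + y) = \<phi> x + \<phi> y" "\<phi> (scl D c x) = scl D c (\<phi> x)"
  and automorphism_br: "\<phi> (br D x y) = br D (\<phi> x) (\<phi> y)"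
  and automorphism_generators: "\<phi> (genE D i) = genE D (\<nu> i)" "\<phi> (genF D i) = genF D (\<nu> i)"
    "\<phi> (coroot D i) = coroot D (\<nu> i)"
  using \<phi> by (auto simp: twisted_automorphism_def lie_automorphism_def Vector_Spaces.linear_iff)

text \<open>The automorphism is prescribed on generators only, so its effect on the whole Cartan
  subalgebra has to be derived. The witness \<open>x'\<close> has the permuted root values; its
  brackets with all \<open>genE\<close> and \<open>genF\<close> agree with those of
  \<open>\<phi> x\<close>, so the two are equal.\<close>

lemma automorphism_csa_rt:
  assumes x: "x \<in> csa D"
  shows "\<phi> x \<in> csa D \<and> rt D (\<nu> i) (\<phi> x) = rt D i x"
proof -
  obtain x' where x': "x' \<in> csa D" "\<And>j. rt D j x' = rt D (inv \<nu> j) x"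
    using ex_csa_rt[of "\<lambda>j. rt D (inv \<nu> j) x"] by auto
  have "\<phi> x - x' = 0"
  proof (rule eq_0_if_commutes_with_generators)
    fix j
    have j: "\<nu> (inv \<nu> j) = j"
      using \<nu> by (simp add: bij_is_surj surj_f_inv_f)
    show "br D (\<phi> x - x') (genE D j) = 0"
      using x' arg_cong[OF br_E[OF x, of "inv \<nu> j"], of \<phi>]
      by (simp add: automorphism_linear automorphism_br automorphism_generators j br_diff_left br_E)
    show "br D (\<phi> x - x') (genF D j) = 0"
      using x' arg_cong[OF br_F[OF x, of "inv \<nu> j"], of \<phi>]
      by (simp only: automorphism_linear automorphism_br automorphism_generators j br_diff_left br_F) simp
  qed
  then show ?thesis
    using x' \<nu> by (simp add: bij_is_inj)
qed

lemma automorphism_funpow_csa: "x \<in> csa D \<Longrightarrow> (\<phi> ^^ r) x \<in> csa D"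
  by (induction r) (simp_all add: automorphism_csa_rt)

lemma automorphism_rho: "\<phi> (rho D) = rho D"
proof -
  have "rt D j (\<phi> (rho D) - rho D) = 0" for j
    using automorphism_csa_rt[OF rho_in_csa, of "inv \<nu> j"] \<nu>
    by (simp add: rt_diff rt_rho bij_is_surj surj_f_inv_f)
  then have "\<phi> (rho D) - rho D = 0"
    by (intro csa_eq_0_if_rt_eq_0) (simp_all add: csa_closed automorphism_csa_rt rho_in_csa)
  then show ?thesis by simp
qed

text \<open>The fixed points form a subalgebra containing the generators.\<close>

lemma automorphism_funpow_id:
  assumes "\<nu> ^^ T = id"
  shows "(\<phi> ^^ T) x = x"
proof -
  have lin: "(\<phi> ^^ r) (x + y) = (\<phi> ^^ r) x + (\<phi> ^^ r) y" "(\<phi> ^^ r) (scl D c x) = scl D c ((\<phi> ^^ r) x)"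
    "(\<phi> ^^ r) (br D x y) = br D ((\<phi> ^^ r) x) ((\<phi> ^^ r) y)" for r x y c
    by (induction r) (simp_all add: automorphism_linear automorphism_br)
  have gen: "(\<phi> ^^ r) (genE D i) = genE D ((\<nu> ^^ r) i)" "(\<phi> ^^ r) (genF D i) = genF D ((\<nu> ^^ r) i)"
    "(\<phi> ^^ r) (coroot D i) = coroot D ((\<nu> ^^ r) i)" for r i
    by (induction r) (simp_all add: automorphism_generators)
  have "(\<phi> ^^ T) 0 = 0"
    using lin(1)[of T 0 0] by simp
  then have "lie_subalgebra D {x. (\<phi> ^^ T) x = x}"
    by (auto simp: lie_subalgebra_def V.subspace_def lin)
  moreover have "range (genE D) \<union> range (coroot D) \<union> range (genF D) \<subseteq> {x. (\<phi> ^^ T) x = x}"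
    using assms by (auto simp: gen)
  ultimately have "UNIV \<subseteq> {x. (\<phi> ^^ T) x = x}"
    unfolding generated[symmetric] by (rule lie_generated_minimal)
  then show ?thesis by auto
qed

end

end

section \<open>Extension of scalars\<close>

context lie_algebra
begin

lemma independent_bas: "V.independent (range (bas D))" and span_bas: "x \<in> V.span (range (bas D))"
  using bas_independent bas_span by auto

lemma coord_add: "coord D (x + y) n = coord D x n + coord D y n"
  by (simp add: coord_def V.representation_add[OF independent_bas span_bas span_bas])

lemma coord_scl: "coord D (scl D c x) n = c * coord D x n"
  by (simp add: coord_def V.representation_scale[OF independent_bas span_bas])

lemma coord_bas: "coord D (bas D m) n = (if m = n then 1 else 0)"
  using bas_inj by (auto simp: coord_def V.representation_basis[OF independent_bas] inj_eq)

lemma sum_coord: "(\<Sum>n\<in>UNIV. scl D (coord D x n) (bas D n)) = x"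
proof -
  have "(\<Sum>v\<in>range (bas D). scl D (V.representation (range (bas D)) x v) v) = x"
    by (rule V.sum_representation_eq[OF independent_bas span_bas]) auto
  then show ?thesis
    by (simp add: sum.reindex[OF bas_inj] coord_def)
qed

lemma tensor_nth: "tensor D x r $ n = r * rconst (coord D x n)"
  by (simp add: tensor_def)

lemma tensor_add_left: "tensor D (x + y) r = tensor D x r + tensor D y r"
  by (simp add: vec_eq_iff tensor_nth coord_add rconst_add algebra_simps)

lemma tensor_add_right: "tensor D x (r + s) = tensor D x r + tensor D x s"
  by (simp add: vec_eq_iff tensor_nth algebra_simps)

lemma tensor_scl: "tensor D (scl D c x) r = tensor D x (rconst c * r)"
  by (simp add: vec_eq_iff tensor_nth coord_scl rconst_mult)

lemma tensor_smult: "s *s tensor D x r = tensor D x (s * r)"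
  by (simp add: vec_eq_iff tensor_nth)

lemma tensor_0_right [simp]: "tensor D x 0 = 0"
  by (simp add: vec_eq_iff tensor_nth)

lemma tensor_0_left [simp]: "tensor D 0 r = 0"
  using tensor_add_left[of 0 0 r] by simp

lemma tensor_minus_left: "tensor D (- x) r = - tensor D x r"
  using tensor_add_left[of x "- x" r] by (simp add: eq_neg_iff_add_eq_0 add.commute)

lemma tensor_sum_left: "tensor D (\<Sum>i\<in>A. h i) r = (\<Sum>i\<in>A. tensor D (h i) r)"
  by (induction A rule: infinite_finite_induct) (simp_all add: tensor_add_left)

lemma tensor_tconst: "tensor D x r = r *s tconst D x"
  by (simp add: tconst_def tensor_smult)

lemma tconst_add: "tconst D (x + y) = tconst D x + tconst D y"
  and tconst_scl: "tconst D (scl D c x) = rconst c *s tconst D x"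
  and tconst_0 [simp]: "tconst D 0 = 0"
  by (simp_all add: tconst_def tensor_add_left tensor_scl tensor_smult)

lemma sum_tensor_bas: "(\<Sum>n\<in>UNIV. tensor D (bas D n) (X $ n)) = X"
  by (simp add: vec_eq_iff tensor_nth coord_bas if_distrib[of rconst] if_distrib[of "(*) _"] cong: if_cong)

lemma tensor_induct [case_names tensor add]:
  assumes "\<And>x r. P (tensor D x r)" "\<And>X Y. P X \<Longrightarrow> P Y \<Longrightarrow> P (X + Y)"
  shows "P X"
proof -
  have "P (\<Sum>n\<in>A. tensor D (bas D n) (X $ n))" if "finite A" for A
    using that
  proof induction
    case empty
    then show ?case using assms(1)[of 0 0] by simp
  qed (simp add: assms)
  from this[of UNIV] show ?thesis
    by (simp add: sum_tensor_bas)
qed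

lemma tbr_add_left: "tbr D (X + X') Y = tbr D X Y + tbr D X' Y"
  by (simp add: tbr_def tensor_add_right algebra_simps sum.distrib)

lemma tbr_add_right: "tbr D X (Y + Y') = tbr D X Y + tbr D X Y'"
  by (simp add: tbr_def tensor_add_right algebra_simps sum.distrib)

lemma tbr_smult_left: "tbr D (r *s X) Y = r *s tbr D X Y"
  by (simp add: tbr_def vec.scale_sum_right tensor_smult mult.assoc)

lemma tbr_smult_right: "tbr D X (r *s Y) = r *s tbr D X Y"
  by (simp add: tbr_def vec.scale_sum_right tensor_smult mult.left_commute)

lemma br_sum_left: "br D (\<Sum>i\<in>A. h i) y = (\<Sum>i\<in>A. br D (h i) y)"
  by (induction A rule: infinite_finite_induct) (simp_all add: br_add_left)

lemma br_sum_right: "br D x (\<Sum>i\<in>A. h i) = (\<Sum>i\<in>A. br D x (h i))"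
  by (induction A rule: infinite_finite_induct) (simp_all add: br_add_right)

lemma tbr_tensor: "tbr D (tensor D x r) (tensor D y s) = tensor D (br D x y) (r * s)"
proof -
  have "br D x y = br D (\<Sum>m\<in>UNIV. scl D (coord D x m) (bas D m)) (\<Sum>n\<in>UNIV. scl D (coord D y n) (bas D n))"
    by (simp add: sum_coord)
  also have "\<dots> = (\<Sum>m\<in>UNIV. \<Sum>n\<in>UNIV.
      scl D (coord D x m) (scl D (coord D y n) (br D (bas D m) (bas D n))))"
    by (simp only: br_sum_left br_scl_left) (simp only: br_sum_right br_scl_right V.scale_sum_right)
  finally have "br D x y = \<dots>" .
  then show ?thesis
    by (simp add: tbr_def tensor_nth tensor_sum_left tensor_scl rconst_mult mult_ac)
qed

lemma tbr_tconst: "tbr D (tconst D x) (tconst D y) = tconst D (br D x y)"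
  by (simp add: tconst_def tbr_tensor)

lemma tbr_0_left [simp]: "tbr D 0 Y = 0"
  using tbr_add_left[of 0 0 Y] by simp

lemma tbr_0_right [simp]: "tbr D X 0 = 0"
  using tbr_add_right[of X 0 0] by simp

lemma tbr_minus_left: "tbr D (- X) Y = - tbr D X Y"
  using tbr_add_left[of X "- X" Y] by (simp add: eq_neg_iff_add_eq_0 add.commute)

lemma tbr_minus_right: "tbr D X (- Y) = - tbr D X Y"
  using tbr_add_right[of X Y "- Y"] by (simp add: eq_neg_iff_add_eq_0 add.commute)

lemma tbr_diff_left: "tbr D (X - X') Y = tbr D X Y - tbr D X' Y"
  using tbr_add_left[of X "- X'" Y] by (simp add: tbr_minus_left)

lemma tbr_sum_left: "tbr D (\<Sum>i\<in>A. h i) Y = (\<Sum>i\<in>A. tbr D (h i) Y)"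
  by (induction A rule: infinite_finite_induct) (simp_all add: tbr_add_left)

lemma tbr_sum_right: "tbr D X (\<Sum>i\<in>A. h i) = (\<Sum>i\<in>A. tbr D X (h i))"
  by (induction A rule: infinite_finite_induct) (simp_all add: tbr_add_right)

lemma tbr_anticommute: "tbr D X Y = - tbr D Y X"
proof (induction X rule: tensor_induct)
  case (tensor x r)
  show ?case
  proof (induction Y rule: tensor_induct)
    case (tensor y s)
    then show ?case
      by (simp add: tbr_tensor br_anticommute[of x y] tensor_minus_left mult.commute)
  qed (simp add: tbr_add_left tbr_add_right)
qed (simp add: tbr_add_left tbr_add_right)

lemma tbr_derivation: "tbr D X (tbr D Y Z) = tbr D (tbr D X Y) Z + tbr D Y (tbr D X Z)"
proof (induction X rule: tensor_induct)
  case (tensor x r)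
  show ?case
  proof (induction Y rule: tensor_induct)
    case (tensor y s)
    show ?case
    proof (induction Z rule: tensor_induct)
      case (tensor z t)
      then show ?case
        by (simp add: tbr_tensor br_derivation[of x y z] tensor_add_left mult_ac)
    qed (simp add: tbr_add_right)
  qed (simp add: tbr_add_left tbr_add_right)
qed (simp add: tbr_add_left tbr_add_right)

lemma tmap_add: "tmap D \<phi> (X + Y) = tmap D \<phi> X + tmap D \<phi> Y"
  by (simp add: tmap_def tensor_add_right sum.distrib)

lemma tmap_smult: "tmap D \<phi> (r *s X) = r *s tmap D \<phi> X"
  by (simp add: tmap_def vec.scale_sum_right tensor_smult)

lemma tmap_tensor:
  assumes "Vector_Spaces.linear (scl D) (scl D) \<phi>"
  shows "tmap D \<phi> (tensor D x r) = tensor D (\<phi> x) r"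
proof -
  interpret L: Vector_Spaces.linear "scl D" "scl D" \<phi> by fact
  have "\<phi> x = \<phi> (\<Sum>n\<in>UNIV. scl D (coord D x n) (bas D n))"
    by (simp add: sum_coord)
  also have "\<dots> = (\<Sum>n\<in>UNIV. scl D (coord D x n) (\<phi> (bas D n)))"
    by (simp add: L.sum L.scale)
  finally show ?thesis
    by (simp add: tmap_def tensor_nth tensor_sum_left tensor_scl mult.commute)
qed

lemma tderiv_add: "tderiv (X + Y) = tderiv X + tderiv (Y :: ratfun ^ 'n)"
  by (simp add: tderiv_def vec_eq_iff rderiv_add)

lemma tderiv_smult: "tderiv (r *s X) = rderiv r *s X + r *s tderiv (X :: ratfun ^ 'n)"
  by (simp add: tderiv_def vec_eq_iff rderiv_mult)

lemma tderiv_tensor: "tderiv (tensor D x r) = tensor D x (rderiv r)"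
  by (simp add: tderiv_def vec_eq_iff tensor_nth rderiv_mult)

lemma tderiv_sum: "tderiv (\<Sum>i\<in>A. h i :: ratfun ^ 'n) = (\<Sum>i\<in>A. tderiv (h i))"
  by (simp add: tderiv_def vec_eq_iff rderiv_sum)

lemma tderiv_tbr: "tderiv (tbr D X Y) = tbr D (tderiv X) Y + tbr D X (tderiv Y)"
proof (induction X rule: tensor_induct)
  case (tensor x r)
  show ?case
  proof (induction Y rule: tensor_induct)
    case (tensor y s)
    then show ?case
      by (simp add: tbr_tensor tderiv_tensor rderiv_mult tensor_add_right)
  qed (simp add: tbr_add_right tderiv_add)
qed (simp add: tbr_add_left tderiv_add)

context
  fixes c :: complex
  assumes c: "c \<noteq> 0"
begin

lemma tscale_add: "tscale c (X + Y) = tscale c X + tscale c (Y :: ratfun ^ 'n)"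
  by (simp add: tscale_def vec_eq_iff rscale_add[OF c])

lemma tscale_smult: "tscale c (r *s X) = rscale c r *s tscale c (X :: ratfun ^ 'n)"
  by (simp add: tscale_def vec_eq_iff rscale_mult[OF c])

lemma tscale_tensor: "tscale c (tensor D x r) = tensor D x (rscale c r)"
  by (simp add: tscale_def vec_eq_iff tensor_nth rscale_mult[OF c])

lemma tscale_tscale_inverse: "tscale c (tscale (inverse c) X) = (X :: ratfun ^ 'n)"
  using c by (simp add: tscale_def vec_eq_iff rscale_rscale)

end

text \<open>Applied to residues in the theorem, and to Laurent coefficients in order to deduce that
  the extended Lie algebra has trivial center from the same fact over the complex numbers.\<close>

definition tfunctional :: "(ratfun \<Rightarrow> complex) \<Rightarrow> ratfun ^ 'n \<Rightarrow> 'g" where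
  "tfunctional h X = (\<Sum>n\<in>UNIV. scl D (h (X $ n)) (bas D n))"

context
  fixes h :: "ratfun \<Rightarrow> complex"
  assumes h_add: "\<And>r s. h (r + s) = h r + h s" and h_rconst: "\<And>c r. h (rconst c * r) = c * h r"
begin

lemma tfunctional_add: "tfunctional h (X + Y) = tfunctional h X + tfunctional h Y"
  by (simp add: tfunctional_def h_add V.scale_left_distrib sum.distrib)

lemma tfunctional_tensor: "tfunctional h (tensor D x r) = scl D (h r) x"
proof -
  have "tfunctional h (tensor D x r) = (\<Sum>n\<in>UNIV. scl D (h r) (scl D (coord D x n) (bas D n)))"
  proof -
    have "h (r * rconst c) = h r * c" for c
      by (metis h_rconst mult.commute)
    then show ?thesis
      by (simp add: tfunctional_def tensor_nth)
  qed
  then show ?thesis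
    by (simp only: V.scale_sum_right[symmetric] sum_coord)
qed

lemma tfunctional_sum: "tfunctional h (\<Sum>i\<in>A. X i) = (\<Sum>i\<in>A. tfunctional h (X i))"
proof -
  have "tfunctional h 0 = 0"
    using tfunctional_add[of 0 0] by simp
  then show ?thesis
    by (induction A rule: infinite_finite_induct) (simp_all add: tfunctional_add)
qed

lemma tfunctional_tbr_tconst: "tfunctional h (tbr D X (tconst D y)) = br D (tfunctional h X) y"
proof (induction X rule: tensor_induct)
  case (tensor x r)
  then show ?case
    by (simp add: tconst_def tbr_tensor tfunctional_tensor br_scl_left)
qed (simp add: tbr_add_left tfunctional_add br_add_left)

lemma tfunctional_eq_0D:
  fixes X :: "ratfun ^ 'n"
  assumes "tfunctional h X = 0"
  shows "h (X $ n) = 0"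
proof -
  have "coord D 0 n = (\<Sum>m\<in>UNIV. coord D (scl D (h (X $ m)) (bas D m)) n)"
  proof -
    have "coord D (\<Sum>m\<in>A. k m) n = (\<Sum>m\<in>A. coord D (k m) n)" for A :: "'n set" and k
      using coord_add[of 0 0 n]
      by (induction A rule: infinite_finite_induct) (simp_all add: coord_add)
    then have "coord D (tfunctional h X) n = (\<Sum>m\<in>UNIV. coord D (scl D (h (X $ m)) (bas D m)) n)"
      unfolding tfunctional_def by this
    then show ?thesis
      using assms by simp
  qed
  moreover have "coord D 0 n = 0"
    using coord_add[of 0 0 n] by simp
  ultimately show ?thesis
    by (simp add: coord_scl coord_bas if_distrib[of "(*) _"] cong: if_cong)
qed

end

lemma tres_eq: "tres D a = tfunctional (rres a)" and tres_inf_eq: "tres_inf D = tfunctional rres_inf"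
  by (simp_all add: fun_eq_iff tres_def tres_inf_def tfunctional_def)

lemma rres_0_linear: "rres 0 (r + s) = rres 0 r + rres 0 s" "rres 0 (rconst c * r) = c * rres 0 r"
  by (simp_all add: rres_0 at_zero_simps)

lemma rres_inf_linear: "rres_inf (r + s) = rres_inf r + rres_inf s"
    "rres_inf (rconst c * r) = c * rres_inf r"
  by (simp_all add: rres_inf at_inf_simps)

end

context semisimple_lie_data
begin

lemma tpair_add: "tpair D i (X + Y) = tpair D i X + tpair D i Y"
  by (simp add: tpair_def algebra_simps sum.distrib)

lemma tpair_smult: "tpair D i (r *s X) = r * tpair D i X"
  by (simp add: tpair_def sum_distrib_left mult.assoc)

lemma tpair_0 [simp]: "tpair D i 0 = 0"
  using tpair_smult[of i 0 0] by simp

lemma tpair_minus: "tpair D i (- X) = - tpair D i X"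
  using tpair_add[of i X "- X"] by (simp add: eq_neg_iff_add_eq_0 add.commute)

lemma tpair_diff: "tpair D i (X - Y) = tpair D i X - tpair D i Y"
  using tpair_add[of i X "- Y"] by (simp add: tpair_minus)

lemma tpair_sum: "tpair D i (\<Sum>j\<in>A. X j) = (\<Sum>j\<in>A. tpair D i (X j))"
  by (induction A rule: infinite_finite_induct) (simp_all add: tpair_add)

lemma tpair_tensor: "tpair D i (tensor D x r) = r * rconst (rt D i x)"
proof -
  have "rt D i x = rt D i (\<Sum>n\<in>UNIV. scl D (coord D x n) (bas D n))"
    by (simp add: sum_coord)
  also have "\<dots> = (\<Sum>n\<in>UNIV. coord D x n * rt D i (bas D n))"
    by (simp add: rt_sum rt_scl)
  finally show ?thesis
    by (simp add: tpair_def tensor_nth rconst_sum rconst_mult sum_distrib_left mult.assoc)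
qed

lemma tpair_tconst: "tpair D i (tconst D x) = rconst (rt D i x)"
  by (simp add: tconst_def tpair_tensor)

lemma rt_tfunctional:
  assumes "\<And>r s. h (r + s) = h r + h s" "\<And>c r. h (rconst c * r) = c * h r"
  shows "rt D i (tfunctional h X) = h (tpair D i X)"
proof (induction X rule: tensor_induct)
  case (tensor x r)
  then show ?case
    using assms by (simp add: tfunctional_tensor rt_scl tpair_tensor mult.commute)
qed (simp add: assms tfunctional_add rt_add tpair_add)

text \<open>Taking a Laurent coefficient at the origin commutes with brackets by constant elements,
  so every coefficient of \<open>X\<close> is a central element over the complex numbers, hence
  zero.\<close>

lemma tcenter_trivial:
  assumes "\<And>Y. tbr D X Y = 0"
  shows "X = 0"
proof -
  have "at_zero (X $ n) = 0" for n
  proof (rule fls_eqI)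
    fix k
    let ?h = "\<lambda>r. fls_nth (at_zero r) k"
    have h: "?h (r + s) = ?h r + ?h s" "?h (rconst c * r) = c * ?h r" for r s c
      by (simp_all add: at_zero_simps)
    have "br D (tfunctional ?h X) y = 0" for y
      using tfunctional_tbr_tconst[OF h, of X y] tfunctional_tensor[OF h, of 0 0] assms by simp
    then have "tfunctional ?h X = 0"
      by (rule center_trivial)
    then show "?h (X $ n) = fls_nth 0 k"
      using tfunctional_eq_0D[OF h] by simp
  qed
  then show ?thesis
    by (simp add: vec_eq_iff)
qed

lemma tspace_induct [consumes 1, case_names tensor add]:
  assumes "X \<in> tspace D S" "\<And>x r. x \<in> S \<Longrightarrow> P (tensor D x r)"
    "P 0" "\<And>X Y. P X \<Longrightarrow> P Y \<Longrightarrow> P (X + Y)"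
  shows "P X"
  using assms(1) unfolding tspace_def
proof (induction rule: vec.span_induct_alt)
  case (step r Z X)
  then show ?case
    using assms(2,4) by (auto simp: tensor_tconst)
qed (fact assms(3))

lemma tensor_in_tspace: "x \<in> S \<Longrightarrow> tensor D x r \<in> tspace D S"
  unfolding tspace_def tensor_tconst by (intro vec.span_scale vec.span_base) auto

lemma tbr_csa_E:
  assumes "X \<in> tspace D (csa D)"
  shows "tbr D X (tconst D (genE D i)) = tpair D i X *s tconst D (genE D i)"
  using assms
proof (induction rule: tspace_induct)
  case (tensor x r)
  then show ?case
    by (simp add: tconst_def tbr_tensor br_E tensor_scl tpair_tensor tensor_smult mult.commute)
qed (simp_all add: tbr_add_left tpair_add vec.scale_left_distrib)

end

section \<open>Exponentials of nilpotent elements\<close>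

context lie_algebra
begin

text \<open>The divided power \<open>ad(X)^n / n!\<close>, a term of the exponential series. With
  this normalization the Leibniz and exponential rules contain no binomial coefficients.\<close>

definition dpow :: "ratfun ^ 'n \<Rightarrow> nat \<Rightarrow> ratfun ^ 'n \<Rightarrow> ratfun ^ 'n" where
  "dpow X n Y = rconst (1 / fact n) *s (tbr D X ^^ n) Y"

text \<open>The exponent is uniform in \<open>Y\<close>, so that one finite sum computes
  \<open>texp D X\<close> on all arguments.\<close>

definition ad_nilpotent :: "ratfun ^ 'n \<Rightarrow> bool" where
  "ad_nilpotent X \<longleftrightarrow> (\<exists>N. \<forall>Y. (tbr D X ^^ N) Y = 0)"

lemma funpow_tbr_add: "(tbr D X ^^ n) (Y + Z) = (tbr D X ^^ n) Y + (tbr D X ^^ n) Z"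
  by (induction n) (simp_all add: tbr_add_right)

lemma funpow_tbr_smult: "(tbr D X ^^ n) (r *s Y) = r *s (tbr D X ^^ n) Y"
  by (induction n) (simp_all add: tbr_smult_right)

lemma funpow_tbr_0 [simp]: "(tbr D X ^^ n) 0 = 0"
  by (induction n) simp_all

lemma funpow_tbr_smult_left: "(tbr D (r *s X) ^^ n) Y = r ^ n *s (tbr D X ^^ n) Y"
  by (induction n) (simp_all add: tbr_smult_left tbr_smult_right)

lemma funpow_tbr_eq_0_mono: "(tbr D X ^^ n) Y = 0 \<Longrightarrow> n \<le> m \<Longrightarrow> (tbr D X ^^ m) Y = 0"
  by (metis funpow_add funpow_tbr_0 le_add_diff_inverse2 o_apply)

lemma dpow_eq_0_iff: "dpow X n Y = 0 \<longleftrightarrow> (tbr D X ^^ n) Y = 0"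
  by (simp add: dpow_def)

lemma dpow_vanishes: "(tbr D X ^^ n) Y = 0 \<Longrightarrow> n \<le> m \<Longrightarrow> dpow X m Y = 0"
  by (simp add: dpow_eq_0_iff funpow_tbr_eq_0_mono)

lemma dpow_0_right [simp]: "dpow X n 0 = 0"
  by (simp add: dpow_eq_0_iff)

lemma dpow_0 [simp]: "dpow X 0 Y = Y"
  by (simp add: dpow_def)

lemma dpow_add_right: "dpow X n (Y + Z) = dpow X n Y + dpow X n Z"
  by (simp add: dpow_def funpow_tbr_add vec.scale_right_distrib)

lemma dpow_smult: "dpow X n (r *s Y) = r *s dpow X n Y"
  by (simp add: dpow_def funpow_tbr_smult mult.commute)

lemma tbr_dpow: "tbr D X (dpow X n Y) = rconst (of_nat (Suc n)) *s dpow X (Suc n) Y"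
proof -
  have "1 / fact n = of_nat (Suc n) * (1 / fact (Suc n) :: complex)"
    by (simp del: of_nat_Suc)
  then show ?thesis
    by (simp only: dpow_def tbr_smult_right vec.scale_scale rconst_mult[symmetric] funpow.simps o_apply)
qed

lemma dpow_Suc: "dpow X (Suc n) Y = rconst (1 / of_nat (Suc n)) *s tbr D X (dpow X n Y)"
  by (simp add: tbr_dpow flip: rconst_mult del: of_nat_Suc)

text \<open>The common source of the Leibniz rule and of the exponential law for commuting elements:
  \<open>c k l\<close> is the product of a \<open>k\<close>-th and an \<open>l\<close>-th divided power.\<close>

lemma dpow_binomial:
  assumes "c 0 0 = Y"
    and c: "\<And>k l. tbr D X (c k l) = rconst (of_nat (Suc k)) *s c (Suc k) l + rconst (of_nat (Suc l)) *s c k (Suc l)"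
  shows "dpow X n Y = (\<Sum>k\<le>n. c k (n - k))"
proof (induction n)
  case (Suc n)
  have "tbr D X (dpow X n Y) =
      (\<Sum>k\<le>n. rconst (of_nat (Suc k)) *s c (Suc k) (n - k)) +
      (\<Sum>k\<le>n. rconst (of_nat (Suc (n - k))) *s c k (Suc (n - k)))"
    by (simp only: Suc tbr_sum_right c sum.distrib)
  \<comment> \<open>The shifted sum gains the term \<open>k = 0\<close>, and the next one the term
    \<open>k = Suc n\<close>, both with factor zero. The weights \<open>k\<close> and
    \<open>Suc n - k\<close> then add up to \<open>Suc n\<close>.\<close>
  also have "(\<Sum>k\<le>n. rconst (of_nat (Suc k)) *s c (Suc k) (n - k)) =
      (\<Sum>k\<le>Suc n. rconst (of_nat k) *s c k (Suc n - k))"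
    by (simp add: sum.atMost_Suc_shift del: sum.atMost_Suc of_nat_Suc)
  also have "(\<Sum>k\<le>n. rconst (of_nat (Suc (n - k))) *s c k (Suc (n - k))) =
      (\<Sum>k\<le>Suc n. rconst (of_nat (Suc n - k)) *s c k (Suc n - k))"
    by (simp add: Suc_diff_le del: of_nat_Suc of_nat_diff)
  also have "(\<Sum>k\<le>Suc n. rconst (of_nat k) *s c k (Suc n - k)) +
      (\<Sum>k\<le>Suc n. rconst (of_nat (Suc n - k)) *s c k (Suc n - k)) =
      (\<Sum>k\<le>Suc n. rconst (of_nat (Suc n)) *s c k (Suc n - k))"
    unfolding sum.distrib[symmetric]
    by (intro sum.cong refl) (simp add: of_nat_diff vec.scale_left_distrib[symmetric] rconst_add[symmetric] del: of_nat_Suc)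
  also have "\<dots> = rconst (of_nat (Suc n)) *s (\<Sum>k\<le>Suc n. c k (Suc n - k))"
    by (simp only: vec.scale_sum_right)
  finally show ?case
    by (simp add: dpow_Suc flip: rconst_mult del: of_nat_Suc sum.atMost_Suc)
qed (use assms in simp)

lemma dpow_tbr: "dpow X n (tbr D Y Z) = (\<Sum>k\<le>n. tbr D (dpow X k Y) (dpow X (n - k) Z))"
  by (rule dpow_binomial[where c = "\<lambda>k l. tbr D (dpow X k Y) (dpow X l Z)"])
    (simp_all only: dpow_0 tbr_derivation tbr_dpow tbr_smult_left tbr_smult_right)

text \<open>By the Leibniz rule the elements killed by some power of \<open>tbr D X\<close> form a
  subalgebra: each term of the \<open>(m + n)\<close>-th power puts at least \<open>m\<close>
  brackets on one factor or at least \<open>n\<close> on the other. A finite basis then yields a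
  common exponent.\<close>

lemma ad_nilpotent_on_generators:
  assumes "lie_generated D S = UNIV" "\<And>y. y \<in> S \<Longrightarrow> \<exists>n. (tbr D X ^^ n) (tconst D y) = 0"
  shows "ad_nilpotent X"
proof -
  let ?L = "{y. \<exists>n. (tbr D X ^^ n) (tconst D y) = 0}"
  have "lie_subalgebra D ?L"
    unfolding lie_subalgebra_def V.subspace_def
  proof (intro conjI ballI allI)
    show "0 \<in> ?L"
      by simp
  next
    fix y z assume "y \<in> ?L" "z \<in> ?L"
    then obtain m n where m: "(tbr D X ^^ m) (tconst D y) = 0" and n: "(tbr D X ^^ n) (tconst D z) = 0"
      by auto
    then have "(tbr D X ^^ (m + n)) (tconst D y) = 0" "(tbr D X ^^ (m + n)) (tconst D z) = 0"
      by (auto elim: funpow_tbr_eq_0_mono)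
    then show "y + z \<in> ?L"
      by (auto simp: tconst_add funpow_tbr_add intro!: exI[of _ "m + n"])
    have "tbr D (dpow X k (tconst D y)) (dpow X (m + n - k) (tconst D z)) = 0" for k
    proof (cases "m \<le> k")
      case True
      then show ?thesis
        using funpow_tbr_eq_0_mono[OF m] by (simp add: dpow_eq_0_iff[THEN iffD2])
    next
      case False
      then have "n \<le> m + n - k" by simp
      then show ?thesis
        using funpow_tbr_eq_0_mono[OF n] by (simp add: dpow_eq_0_iff[THEN iffD2])
    qed
    then have "dpow X (m + n) (tconst D (br D y z)) = 0"
      by (simp add: dpow_tbr flip: tbr_tconst)
    then show "br D y z \<in> ?L"
      by (auto simp: dpow_eq_0_iff)
  next
    fix c y assume "y \<in> ?L"
    then show "scl D c y \<in> ?L"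
      by (auto simp: tconst_scl funpow_tbr_smult)
  qed
  then have "UNIV \<subseteq> ?L"
    unfolding assms(1)[symmetric] using assms(2) by (intro lie_generated_minimal) auto
  then have "\<forall>m. \<exists>n. (tbr D X ^^ n) (tconst D (bas D m)) = 0"
    by auto
  then obtain N where N: "\<And>m. (tbr D X ^^ N m) (tconst D (bas D m)) = 0"
    by metis
  have bas: "(tbr D X ^^ Max (range N)) (tconst D (bas D m)) = 0" for m
    by (rule funpow_tbr_eq_0_mono[OF N]) simp
  have "(tbr D X ^^ Max (range N)) (\<Sum>m\<in>A. tensor D (bas D m) (Y $ m)) = 0" for Y A
    by (induction A rule: infinite_finite_induct)
      (simp_all add: funpow_tbr_add tensor_tconst funpow_tbr_smult bas)
  from this[where A = UNIV] show ?thesis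
    unfolding ad_nilpotent_def sum_tensor_bas by blast
qed

lemma ad_nilpotent_smult: "ad_nilpotent X \<Longrightarrow> ad_nilpotent (r *s X)"
  by (auto simp: ad_nilpotent_def funpow_tbr_smult_left)

lemma ad_nilpotent_uminus: "ad_nilpotent X \<Longrightarrow> ad_nilpotent (- X)"
  using ad_nilpotent_smult[of X "- 1"] by simp

lemma ad_nilpotent_0: "ad_nilpotent 0"
  unfolding ad_nilpotent_def by (intro exI[of _ 1]) simp

lemma texp_eq:
  assumes "(tbr D X ^^ n) Y = 0"
  shows "texp D X Y = (\<Sum>j<n. dpow X j Y)"
proof -
  have "j < n" if "(tbr D X ^^ j) Y \<noteq> 0" for j
    using assms that by (metis funpow_tbr_eq_0_mono not_le)
  then show ?thesis
    unfolding texp_def dpow_def[symmetric]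
    by (intro sum.mono_neutral_left) (auto simp: dpow_eq_0_iff)
qed

lemma texp_0 [simp]: "texp D 0 Y = Y"
  using texp_eq[where X = 0 and n = 1] by simp

lemma dpow_commute:
  assumes "tbr D X Y = 0"
  shows "tbr D Y (dpow X n Z) = dpow X n (tbr D Y Z)"
proof -
  have "tbr D Y (tbr D X W) = tbr D X (tbr D Y W)" for W
    using tbr_derivation[of X Y W] assms by simp
  then have "tbr D Y ((tbr D X ^^ n) Z) = (tbr D X ^^ n) (tbr D Y Z)"
    by (induction n) simp_all
  then show ?thesis
    by (simp add: dpow_def tbr_smult_right)
qed

lemma dpow_sum:
  assumes "tbr D X Y = 0"
  shows "dpow (X + Y) n Z = (\<Sum>k\<le>n. dpow X k (dpow Y (n - k) Z))"
  by (rule dpow_binomial[where c = "\<lambda>k l. dpow X k (dpow Y l Z)"])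
    (simp_all only: dpow_0 tbr_add_left dpow_commute[OF assms] tbr_dpow dpow_smult)

lemma dpow_sum_vanishes:
  assumes "\<forall>Z. (tbr D X ^^ m) Z = 0" "\<forall>Z. (tbr D Y ^^ n) Z = 0" "m \<le> k \<or> n \<le> l"
  shows "dpow X k (dpow Y l Z) = 0"
  using assms by (metis dpow_0_right dpow_vanishes)

lemma ad_nilpotent_add:
  assumes "ad_nilpotent X" "ad_nilpotent Y" "tbr D X Y = 0"
  shows "ad_nilpotent (X + Y)"
proof -
  obtain m n where "\<forall>Z. (tbr D X ^^ m) Z = 0" "\<forall>Z. (tbr D Y ^^ n) Z = 0"
    using assms by (auto simp: ad_nilpotent_def)
  then have "dpow (X + Y) (m + n) Z = 0" for Z
    unfolding dpow_sum[OF assms(3)] by (intro sum.neutral ballI dpow_sum_vanishes[of m X n Y]) auto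
  then show ?thesis
    by (auto simp: dpow_eq_0_iff ad_nilpotent_def)
qed

lemma texp_add:
  assumes "ad_nilpotent X" "ad_nilpotent Y" "tbr D X Y = 0"
  shows "texp D (X + Y) Z = texp D X (texp D Y Z)"
proof -
  obtain m n where m: "\<forall>Z. (tbr D X ^^ m) Z = 0" and n: "\<forall>Z. (tbr D Y ^^ n) Z = 0"
    using assms by (auto simp: ad_nilpotent_def)
  have sums: "dpow X k (\<Sum>l\<in>A. W l) = (\<Sum>l\<in>A. dpow X k (W l))" for k and A :: "nat set" and W
    by (induction A rule: infinite_finite_induct) (simp_all add: dpow_add_right dpow_eq_0_iff)
  have "dpow (X + Y) (m + n) Z = 0"
    unfolding dpow_sum[OF assms(3)]
    by (intro sum.neutral ballI dpow_sum_vanishes[OF m n]) auto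
  then have "texp D (X + Y) Z = (\<Sum>j<m + n. dpow (X + Y) j Z)"
    by (intro texp_eq) (simp add: dpow_eq_0_iff)
  also have "\<dots> = (\<Sum>j<m + n. \<Sum>k\<le>j. dpow X k (dpow Y (j - k) Z))"
    by (simp only: dpow_sum[OF assms(3)])
  also have "\<dots> = (\<Sum>(k, l)\<in>{(k, l). k + l < m + n}. dpow X k (dpow Y l Z))"
    by (rule sum.triangle_reindex[symmetric])
  \<comment> \<open>Terms with \<open>m \<le> k\<close> or \<open>n \<le> l\<close> vanish, which
    cuts the triangle down to the rectangle over which the two exponentials are summed.\<close>
  also have "\<dots> = (\<Sum>(k, l)\<in>{..<m} \<times> {..<n}. dpow X k (dpow Y l Z))"
  proof (rule sum.mono_neutral_right)
    show "finite {(k, l). k + l < m + n}"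
      by (rule finite_subset[of _ "{..<m + n} \<times> {..<m + n}"]) auto
    show "\<forall>p\<in>{(k, l). k + l < m + n} - {..<m} \<times> {..<n}. (case p of (k, l) \<Rightarrow> dpow X k (dpow Y l Z)) = 0"
    proof
      fix p assume "p \<in> {(k, l). k + l < m + n} - {..<m} \<times> {..<n}"
      then show "(case p of (k, l) \<Rightarrow> dpow X k (dpow Y l Z)) = 0"
        using dpow_sum_vanishes[OF m n] by (cases p) auto
    qed
  qed auto
  also have "\<dots> = texp D X (texp D Y Z)"
    using m n by (simp add: texp_eq[where X = X and n = m] texp_eq[where X = Y and n = n] sums sum.cartesian_product)
  finally show ?thesis .
qed

lemma tbr_self [simp]: "tbr D X X = 0"
proof -
  have "tbr D X X + tbr D X X = 0"
    using tbr_anticommute[of X X] by (simp add: eq_neg_iff_add_eq_0)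
  then have "rconst 2 *s tbr D X X = 0"
    by (simp only: one_add_one[symmetric] rconst_add rconst_simps vec.scale_left_distrib vec.scale_one)
  then show ?thesis
    by (simp only: vec.scale_eq_0_iff rconst_eq_0_iff) simp
qed

lemma texp_texp_uminus:
  assumes "ad_nilpotent X"
  shows "texp D X (texp D (- X) Y) = Y"
  using texp_add[OF assms ad_nilpotent_uminus[OF assms], of Y] by (simp add: tbr_minus_right)

text \<open>As \<open>tderiv X\<close> commutes with \<open>X\<close>, the \<open>n\<close> terms
  produced by differentiating the factors \<open>X\<close> coincide, and the factor \<open>n\<close>
  turns \<open>1 / n!\<close> into \<open>1 / (n - 1)!\<close>.\<close>

lemma tderiv_dpow:
  assumes "tbr D X (tderiv X) = 0"
  shows "tderiv (dpow X n Y) = dpow X n (tderiv Y) +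
    (if n = 0 then 0 else tbr D (tderiv X) (dpow X (n - 1) Y))"
proof (induction n)
  case (Suc n)
  have comm: "tbr D X (tbr D (tderiv X) W) = tbr D (tderiv X) (tbr D X W)" for W
    using tbr_derivation[of X "tderiv X" W] assms by simp
  have "tderiv (tbr D X (dpow X n Y)) =
      tbr D (tderiv X) (dpow X n Y) + tbr D X (dpow X n (tderiv Y)) +
      (if n = 0 then 0 else tbr D (tderiv X) (tbr D X (dpow X (n - 1) Y)))"
    by (simp add: tderiv_tbr Suc tbr_add_right comm)
  also have "(if n = 0 then 0 else tbr D (tderiv X) (tbr D X (dpow X (n - 1) Y))) =
      rconst (of_nat n) *s tbr D (tderiv X) (dpow X n Y)"
    by (cases n) (simp_all only: tbr_dpow tbr_smult_right diff_Suc_1 if_False nat.distinct simp_thms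
        if_True of_nat_0 rconst_simps vec.scale_zero_left)
  finally have "tderiv (tbr D X (dpow X n Y)) = rconst (of_nat (Suc n)) *s
      (dpow X (Suc n) (tderiv Y) + tbr D (tderiv X) (dpow X n Y))"
    by (simp add: tbr_dpow rconst_add vec.scale_left_distrib vec.scale_right_distrib)
  then show ?case
    by (simp add: dpow_Suc[of X n Y] tderiv_smult flip: rconst_mult del: of_nat_Suc)
qed simp

lemma tderiv_texp:
  assumes "ad_nilpotent X" "tbr D X (tderiv X) = 0"
  shows "tderiv (texp D X Y) = texp D X (tderiv Y) + tbr D (tderiv X) (texp D X Y)"
proof -
  obtain n where n: "\<And>Y. (tbr D X ^^ n) Y = 0"
    using assms by (auto simp: ad_nilpotent_def)
  \<comment> \<open>One term more than necessary, so that \<open>n\<close> terms remain once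
    \<open>j = 0\<close> is dropped and the index shifted.\<close>
  have e: "texp D X Y = (\<Sum>j<Suc n. dpow X j Y)" for Y
    using n by (intro texp_eq) (simp add: n)
  have "(\<Sum>j<Suc n. if j = 0 then 0 else tbr D (tderiv X) (dpow X (j - 1) Y)) =
      (\<Sum>j<n. tbr D (tderiv X) (dpow X j Y))"
    by (subst sum.lessThan_Suc_shift) simp
  also have "\<dots> = tbr D (tderiv X) (texp D X Y)"
    using n by (simp add: texp_eq[where X = X and n = n] tbr_sum_right)
  finally show ?thesis
    unfolding e by (simp only: tderiv_sum tderiv_dpow[OF assms(2)] sum.distrib)
qed

text \<open>Meant for an automorphism combined with a rescaling of the argument, which is linear
  over the constants only; this suffices because \<open>1 / fact j\<close> is constant. Injectivity
  preserves the set of non-zero terms over which \<open>texp\<close> sums.\<close>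

lemma texp_semilinear:
  assumes add: "\<And>X Y. \<Phi> (X + Y) = \<Phi> X + \<Phi> Y" and br: "\<And>X Y. \<Phi> (tbr D X Y) = tbr D (\<Phi> X) (\<Phi> Y)"
    and scale: "\<And>c X. \<Phi> (rconst c *s X) = rconst c *s \<Phi> X" and "inj \<Phi>"
  shows "\<Phi> (texp D X Y) = texp D (\<Phi> X) (\<Phi> Y)"
proof -
  have pow: "\<Phi> ((tbr D X ^^ n) Y) = (tbr D (\<Phi> X) ^^ n) (\<Phi> Y)" for n
    by (induction n) (simp_all add: br)
  have 0: "\<Phi> 0 = 0"
    using add[of 0 0] by simp
  have sum: "\<Phi> (\<Sum>j\<in>A. W j) = (\<Sum>j\<in>A. \<Phi> (W j))" for A :: "nat set" and W
    by (induction A rule: infinite_finite_induct) (simp_all add: add 0)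
  have "\<Phi> W = 0 \<longleftrightarrow> W = 0" for W
    using \<open>inj \<Phi>\<close> 0 by (metis injD)
  then show ?thesis
    by (simp add: texp_def sum scale pow flip: pow)
qed

end

context semisimple_lie_data
begin

text \<open>Uniqueness holds because \<open>texp D X\<close> is onto, with right inverse
  \<open>texp D (- X)\<close>: two candidates differ by an element whose bracket with everything is
  zero.\<close>

lemma log_deriv_texp:
  assumes "ad_nilpotent X" "tbr D X (tderiv X) = 0"
  shows "log_deriv D (texp D X) = tderiv X"
  unfolding log_deriv_def
proof (rule the_equality)
  show "\<forall>Z. tbr D (tderiv X) (texp D X Z) = tderiv (texp D X Z) - texp D X (tderiv Z)"
    by (simp add: tderiv_texp[OF assms])
  fix Y assume "\<forall>Z. tbr D Y (texp D X Z) = tderiv (texp D X Z) - texp D X (tderiv Z)"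
  then have "tbr D (Y - tderiv X) (texp D X Z) = 0" for Z
    by (simp add: tderiv_texp[OF assms] tbr_diff_left)
  then have "tbr D (Y - tderiv X) Z = 0" for Z
    by (metis texp_texp_uminus[OF assms(1)])
  then show "Y = tderiv X"
    using tcenter_trivial by (metis right_minus_eq)
qed

text \<open>The Serre relations settle the other \<open>genE D j\<close>; on coroots and on
  \<open>genF D j\<close> two and three brackets suffice, as in \<open>sl_2\<close>.\<close>

lemma ad_nilpotent_E: "ad_nilpotent (tconst D (genE D i))"
proof (rule ad_nilpotent_on_generators[OF generated])
  fix y assume "y \<in> range (genE D) \<union> range (coroot D) \<union> range (genF D)"
  moreover have pow: "(tbr D (tconst D x) ^^ n) (tconst D y) = tconst D ((br D x ^^ n) y)" for x y n
    by (induction n) (simp_all add: tbr_tconst)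
  moreover have coroot: "br D (genE D i) (coroot D j) = scl D (- rt D i (coroot D j)) (genE D i)" for i j
    using br_anticommute[of "genE D i"] by (simp add: br_E coroot_in_csa)
  have "(br D (genE D i) ^^ 2) (coroot D j) = 0" for j
    by (simp add: numeral_2_eq_2 coroot br_minus_right br_scl_right br_self)
  moreover have "(br D (genE D i) ^^ 3) (genF D j) = 0" for j
    by (simp add: numeral_3_eq_3 br_EF coroot br_minus_right br_scl_right br_self)
  moreover have "\<exists>n. (br D (genE D i) ^^ n) (genE D j) = 0" for j
  proof (cases "i = j")
    case True
    then show ?thesis
      by (intro exI[of _ 1]) (simp add: br_self)
  next
    case False
    then show ?thesis
      by (metis serre_E)
  qed
  ultimately show "\<exists>n. (tbr D (tconst D (genE D i)) ^^ n) (tconst D y) = 0"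
    by (metis (no_types, lifting) UnE imageE tconst_0)
qed

end

section \<open>Gauge transformations along an orbit of commuting simple roots\<close>

context semisimple_lie_data
begin

definition root_element :: "'c set \<Rightarrow> ('c \<Rightarrow> ratfun) \<Rightarrow> ratfun ^ 'b" where
  "root_element J f = (\<Sum>i\<in>J. f i *s tconst D (genE D i))"

context
  fixes J :: "'c set"
  assumes J: "type_A1_power D J"
begin

text \<open>For a vanishing entry of the Cartan matrix the Serre relation has exponent
  \<open>1\<close>.\<close>

lemma br_E_E: "i \<in> J \<Longrightarrow> j \<in> J \<Longrightarrow> br D (genE D i) (genE D j) = 0"
proof (cases "i = j")
  case False
  assume ij: "i \<in> J" "j \<in> J"
  obtain n where n: "cartan_matrix D i j = - of_nat n" "(br D (genE D i) ^^ (n + 1)) (genE D j) = 0"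
    using False by (rule serre_E)
  moreover have "cartan_matrix D i j = 0"
    using J ij False by (simp add: type_A1_power_def)
  ultimately show ?thesis
    by simp
qed (simp add: br_self)

lemma rt_coroot_orthogonal: "i \<in> J \<Longrightarrow> j \<in> J \<Longrightarrow> rt D j (coroot D i) = (if i = j then 2 else 0)"
  using J rt_coroot by (auto simp: type_A1_power_def cartan_matrix_def)

lemma tbr_root_elements: "A \<subseteq> J \<Longrightarrow> B \<subseteq> J \<Longrightarrow> tbr D (root_element A f) (root_element B h) = 0"
  unfolding root_element_def tbr_sum_left tbr_sum_right
proof (intro sum.neutral ballI)
  fix i j assume "A \<subseteq> J" "B \<subseteq> J" "i \<in> A" "j \<in> B"
  then have "br D (genE D i) (genE D j) = 0"
    by (intro br_E_E) auto
  then show "tbr D (f i *s tconst D (genE D i)) (h j *s tconst D (genE D j)) = 0"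
    by (simp add: tbr_smult_left tbr_smult_right tbr_tconst)
qed

lemma ad_nilpotent_root_element: "A \<subseteq> J \<Longrightarrow> ad_nilpotent (root_element A f)"
proof (induction A rule: infinite_finite_induct)
  case (insert i A)
  have "root_element (insert i A) f = root_element {i} f + root_element A f"
    using insert by (simp add: root_element_def)
  then show ?case
    using insert tbr_root_elements[of "{i}" A f f]
    by (simp add: ad_nilpotent_add ad_nilpotent_smult ad_nilpotent_E root_element_def)
qed (simp_all add: root_element_def ad_nilpotent_0)

lemma comp_prod_texp:
  assumes "distinct js" "set js \<subseteq> J"
  shows "comp_prod (\<lambda>i. texp D (f i *s tconst D (genE D i))) js = texp D (root_element (set js) f)"
  using assms
proof (induction js)
  case Nil
  then show ?case
    by (simp add: comp_prod_def root_element_def fun_eq_iff)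
next
  case (Cons i js)
  have "root_element (set (i # js)) f = root_element {i} f + root_element (set js) f"
    using Cons.prems by (simp add: root_element_def)
  moreover have "texp D (f i *s tconst D (genE D i)) = texp D (root_element {i} f)"
    by (simp add: root_element_def)
  moreover have "texp D (root_element {i} f + root_element (set js) f) Z =
      texp D (root_element {i} f) (texp D (root_element (set js) f) Z)" for Z
    using Cons.prems by (intro texp_add ad_nilpotent_root_element tbr_root_elements) auto
  ultimately show ?case
    using Cons by (simp add: comp_prod_def fun_eq_iff)
qed

lemma tderiv_root_element: "tderiv (root_element J f) = root_element J (\<lambda>i. rderiv (f i))"
  by (simp add: root_element_def tderiv_sum tderiv_tensor flip: tensor_tconst)

lemma log_deriv_root_element: "log_deriv D (texp D (root_element J f)) = root_element J (\<lambda>i. rderiv (f i))"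
  using tbr_root_elements[of J J f] tderiv_root_element
  by (simp add: log_deriv_texp ad_nilpotent_root_element)

lemma tbr_root_element_csa:
  assumes "X \<in> tspace D (csa D)"
  shows "tbr D (root_element A f) X = - root_element A (\<lambda>i. f i * tpair D i X)"
  unfolding tbr_anticommute[of _ X]
  by (simp add: root_element_def tbr_sum_right tbr_smult_right tbr_csa_E[OF assms])

text \<open>Bracketing with \<open>genF D j\<close> isolates the coefficient at \<open>j\<close>, as
  a multiple of a coroot on which \<open>rt D j\<close> takes the value \<open>2\<close>.\<close>

lemma root_element_eq_iff:
  "root_element J f = root_element J h \<longleftrightarrow> (\<forall>i\<in>J. f i = h i)"
proof
  assume eq: "root_element J f = root_element J h"
  show "\<forall>i\<in>J. f i = h i"
  proof
    fix j assume j: "j \<in> J"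
    have "tbr D (root_element J r) (tconst D (genF D j)) = r j *s tconst D (coroot D j)" for r
    proof -
      have "tbr D (root_element J r) (tconst D (genF D j)) =
          (\<Sum>i\<in>J. if i = j then r j *s tconst D (coroot D j) else 0)"
        unfolding root_element_def tbr_sum_left
        by (intro sum.cong refl) (simp add: tbr_smult_left tbr_tconst br_EF)
      then show ?thesis
        using j by simp
    qed
    then have "tpair D j (f j *s tconst D (coroot D j)) = tpair D j (h j *s tconst D (coroot D j))"
      using eq by metis
    then have "rconst 2 * f j = rconst 2 * h j"
      by (simp add: tpair_smult tpair_tconst rt_coroot mult.commute)
    then show "f j = h j"
      by (simp only: mult_cancel_left rconst_eq_0_iff) simp
  qed
qed (simp add: root_element_def)

lemma tbr_root_element_p_minus:
  "tbr D (root_element J f) (tconst D (p_minus D)) = (\<Sum>i\<in>J. f i *s tconst D (coroot D i))"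
proof -
  have "br D (genE D i) (p_minus D) = coroot D i" for i
    by (simp add: p_minus_def br_sum_right br_EF)
  then show ?thesis
    by (simp add: root_element_def tbr_sum_left tbr_smult_left tbr_tconst)
qed

lemma sum_coroots_in_tspace: "(\<Sum>i\<in>J. f i *s tconst D (coroot D i)) \<in> tspace D (csa D)"
  unfolding tspace_def
  by (intro vec.span_sum vec.span_scale vec.span_base imageI coroot_in_csa)

lemma tpair_sum_coroots:
  assumes "j \<in> J"
  shows "tpair D j (\<Sum>i\<in>J. f i *s tconst D (coroot D i)) = rconst 2 * f j"
proof -
  have "tpair D j (\<Sum>i\<in>J. f i *s tconst D (coroot D i)) = (\<Sum>i\<in>J. if i = j then rconst 2 * f j else 0)"
    unfolding tpair_sum using assms
    by (intro sum.cong refl) (simp add: tpair_smult tpair_tconst rt_coroot_orthogonal mult.commute)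
  then show ?thesis
    using assms by simp
qed

lemma sum_coroots_eq_iff:
  "(\<Sum>i\<in>J. f i *s tconst D (coroot D i)) = (\<Sum>i\<in>J. h i *s tconst D (coroot D i)) \<longleftrightarrow> (\<forall>i\<in>J. f i = h i)"
proof
  assume eq: "(\<Sum>i\<in>J. f i *s tconst D (coroot D i)) = (\<Sum>i\<in>J. h i *s tconst D (coroot D i))"
  show "\<forall>i\<in>J. f i = h i"
  proof
    fix j assume "j \<in> J"
    then have "rconst 2 * f j = rconst 2 * h j"
      using arg_cong[OF eq, of "tpair D j"] by (simp only: tpair_sum_coroots)
    then show "f j = h j"
      by (simp only: mult_cancel_left rconst_eq_0_iff) simp
  qed
qed simp

text \<open>Three brackets with the root element kill the connection, so the exponential has three
  terms. The bracket with \<open>p_minus D\<close> gives the coroots; a second one turns these into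
  \<open>- 2 (f i)^2\<close> times \<open>genE D i\<close>, halved by the factorial. With the
  bracket of \<open>u\<close> and the logarithmic derivative, the total coefficient of
  \<open>genE D i\<close> is minus the left-hand side of the Riccati equation, and only the coroots
  survive.\<close>

lemma gauge_act_root_element:
  assumes u: "u \<in> tspace D (csa D)"
    and riccati: "\<And>i. i \<in> J \<Longrightarrow> rderiv (f i) + (f i)\<^sup>2 + f i * tpair D i u = 0"
  shows "gauge_act D (texp D (root_element J f)) (tconst D (p_minus D) + u) =
    tconst D (p_minus D) + (u + (\<Sum>i\<in>J. f i *s tconst D (coroot D i)))"
proof -
  let ?X = "root_element J f" and ?p = "tconst D (p_minus D)"
    and ?h = "\<Sum>i\<in>J. f i *s tconst D (coroot D i)"
  let ?u1 = "root_element J (\<lambda>i. f i * tpair D i u)" and ?h1 = "root_element J (\<lambda>i. rconst 2 * f i * f i)"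
  have 1: "tbr D ?X (?p + u) = ?h - ?u1"
    by (simp add: tbr_add_right tbr_root_element_p_minus tbr_root_element_csa[OF u])
  have "tbr D ?X ?h = - ?h1"
    unfolding tbr_root_element_csa[OF sum_coroots_in_tspace] unfolding root_element_def
    by (simp add: tpair_sum_coroots mult_ac)
  then have 2: "tbr D ?X (?h - ?u1) = - ?h1"
    using tbr_root_elements[of J J f] tbr_add_right[of ?X ?h "- ?u1"] by (simp add: tbr_minus_right)
  have 3: "tbr D ?X (- ?h1) = 0"
    using tbr_root_elements[of J J f] by (simp add: tbr_minus_right)
  have "(tbr D ?X ^^ 3) (?p + u) = 0"
    by (simp add: numeral_3_eq_3 1 2 3)
  then have "texp D ?X (?p + u) = (\<Sum>j<3. dpow ?X j (?p + u))"
    by (rule texp_eq)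
  also have "\<dots> = ?p + u + (?h - ?u1) + rconst (1 / 2) *s (- ?h1)"
    by (simp add: numeral_3_eq_3 numeral_2_eq_2 dpow_def 1 2 3)
  also have "rconst (1 / 2) *s (- ?h1) = - root_element J (\<lambda>i. (f i)\<^sup>2)"
  proof -
    have "rconst (1 / 2) * (rconst 2 * f i * f i) = (f i)\<^sup>2" for i
      by (simp add: power2_eq_square mult.assoc[symmetric] flip: rconst_mult)
    then show ?thesis
      by (simp add: root_element_def vec.scale_sum_right vec.scale_minus_right)
  qed
  finally have "gauge_act D (texp D ?X) (?p + u) = ?p + (u + ?h) -
      (root_element J (\<lambda>i. rderiv (f i)) + root_element J (\<lambda>i. (f i)\<^sup>2) + ?u1)"
    by (simp add: gauge_act_def log_deriv_root_element algebra_simps)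
  also have "root_element J (\<lambda>i. rderiv (f i)) + root_element J (\<lambda>i. (f i)\<^sup>2) + ?u1 = 0"
    unfolding root_element_def sum.distrib[symmetric] vec.scale_left_distrib[symmetric]
    by (intro sum.neutral ballI) (simp add: riccati)
  finally show ?thesis
    by simp
qed

lemma texp_root_element_in_unip: "texp D (root_element J f) \<in> unip D"
proof -
  have "root_element J f \<in> tspace D (nil_plus D)"
    unfolding root_element_def tspace_def nil_plus_def
    by (intro vec.span_sum vec.span_scale vec.span_base imageI subsetD[OF lie_generated_incl] rangeI)
  then show ?thesis
    by (simp add: unip_def)
qed

text \<open>As \<open>rho D\<close> pairs to \<open>1\<close> with every simple root, the
  exponential sends it to \<open>rho D\<close> minus the root element, the next bracket being that
  of the root element with itself. So the root element can be read off from the operator.\<close>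

lemma texp_root_element_eq_iff:
  "texp D (root_element J f) = texp D (root_element J h) \<longleftrightarrow> (\<forall>i\<in>J. f i = h i)"
proof
  assume eq: "texp D (root_element J f) = texp D (root_element J h)"
  have "texp D (root_element J r) (tconst D (rho D)) = tconst D (rho D) - root_element J r" for r
  proof -
    have rho: "tconst D (rho D) \<in> tspace D (csa D)"
      using tensor_in_tspace[OF rho_in_csa, of 1] by (simp add: tconst_def)
    have 1: "tbr D (root_element J r) (tconst D (rho D)) = - root_element J r"
      by (simp add: tbr_root_element_csa[OF rho] tpair_tconst rt_rho)
    have 2: "tbr D (root_element J r) (- root_element J r) = 0"
      by (simp add: tbr_minus_right)
    have "(tbr D (root_element J r) ^^ 2) (tconst D (rho D)) = 0"
      by (simp add: numeral_2_eq_2 1 2)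
    then have "texp D (root_element J r) (tconst D (rho D)) = (\<Sum>j<2. dpow (root_element J r) j (tconst D (rho D)))"
      by (rule texp_eq)
    then show ?thesis
      by (simp add: numeral_2_eq_2 dpow_def 1)
  qed
  note texp_rho = this
  have "tconst D (rho D) - root_element J f = tconst D (rho D) - root_element J h"
    unfolding texp_rho[symmetric] eq by (rule refl)
  then have "root_element J f = root_element J h"
    by simp
  then show "\<forall>i\<in>J. f i = h i"
    by (simp only: root_element_eq_iff)
qed (simp add: root_element_def)

end

end

section \<open>Cyclotomic invariance\<close>

context lie_algebra
begin

lemma linear_inv_automorphism:
  assumes "lie_automorphism D \<phi>"
  shows "Vector_Spaces.linear (scl D) (scl D) (inv \<phi>)"
proof -
  interpret L: Vector_Spaces.linear "scl D" "scl D" \<phi>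
    using assms by (simp add: lie_automorphism_def)
  have "bij \<phi>"
    using assms by (simp add: lie_automorphism_def)
  then have inv: "inv \<phi> (\<phi> x) = x" "\<phi> (inv \<phi> x) = x" for x
    by (simp_all add: bij_is_inj bij_is_surj surj_f_inv_f)
  have "inv \<phi> (x + y) = inv \<phi> x + inv \<phi> y" for x y
    using inv L.add by metis
  moreover have "inv \<phi> (scl D c x) = scl D c (inv \<phi> x)" for c x
    using inv L.scale by metis
  ultimately show ?thesis
    by (simp add: Vector_Spaces.linear_iff V.vector_space_axioms)
qed

lemma tmap_inverse:
  assumes "lie_automorphism D \<phi>"
  shows "tmap D \<phi> (tmap D (inv \<phi>) X) = X" "tmap D (inv \<phi>) (tmap D \<phi> X) = X"
proof -
  have lin: "Vector_Spaces.linear (scl D) (scl D) \<phi>" and "bij \<phi>"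
    using assms by (simp_all add: lie_automorphism_def)
  then have "inv \<phi> (\<phi> x) = x" "\<phi> (inv \<phi> x) = x" for x
    by (simp_all add: bij_is_inj bij_is_surj surj_f_inv_f)
  then show "tmap D \<phi> (tmap D (inv \<phi>) X) = X" "tmap D (inv \<phi>) (tmap D \<phi> X) = X"
    by (induction X rule: tensor_induct)
      (simp_all add: tmap_add tmap_tensor lin linear_inv_automorphism[OF assms])
qed

lemma tmap_tbr:
  assumes "lie_automorphism D \<phi>"
  shows "tmap D \<phi> (tbr D X Y) = tbr D (tmap D \<phi> X) (tmap D \<phi> Y)"
proof (induction X rule: tensor_induct)
  case (tensor x r)
  show ?case
  proof (induction Y rule: tensor_induct)
    case (tensor y s)
    then show ?case
      using assms by (simp add: tbr_tensor tmap_tensor lie_automorphism_def)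
  qed (simp add: tbr_add_right tmap_add)
qed (simp add: tbr_add_left tmap_add)

lemma tscale_tbr:
  assumes c: "c \<noteq> 0"
  shows "tscale c (tbr D X Y) = tbr D (tscale c X) (tscale c Y)"
proof (induction X rule: tensor_induct)
  case (tensor x r)
  show ?case
  proof (induction Y rule: tensor_induct)
    case (tensor y s)
    then show ?case
      using c by (simp add: tbr_tensor tscale_tensor rscale_mult)
  qed (simp add: tbr_add_right tscale_add c)
qed (simp add: tbr_add_left tscale_add c)

text \<open>\<open>hat_group\<close> is conjugation by \<open>?\<Phi>\<close>, an automorphism after
  a rescaling of the argument. Since \<open>?\<Phi>\<close> respects brackets, conjugation passes
  into the exponent.\<close>

lemma hat_group_texp:
  assumes \<phi>: "lie_automorphism D \<phi>" and \<omega>: "\<omega> \<noteq> 0"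
  shows "hat_group D \<omega> \<phi> (texp D X) = texp D (tmap D \<phi> (tscale (inverse \<omega>) X))"
proof
  fix Y
  let ?\<Phi> = "\<lambda>X. tmap D \<phi> (tscale (inverse \<omega>) X)"
  let ?\<Psi> = "\<lambda>X. tscale \<omega> (tmap D (inv \<phi>) X)"
  have inv: "?\<Phi> (?\<Psi> X) = X" "?\<Psi> (?\<Phi> X) = X" for X
    using \<omega> tscale_tscale_inverse[of \<omega>] tscale_tscale_inverse[of "inverse \<omega>"]
    by (simp_all add: tmap_inverse[OF \<phi>])
  have "inj ?\<Phi>"
    using inv(2) by (rule inj_on_inverseI)
  then have "?\<Phi> (texp D X (?\<Psi> Y)) = texp D (?\<Phi> X) (?\<Phi> (?\<Psi> Y))"
    using \<omega> by (intro texp_semilinear)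
      (simp_all add: tmap_add tscale_add tmap_tbr[OF \<phi>] tscale_tbr tscale_smult tmap_smult)
  then show "hat_group D \<omega> \<phi> (texp D X) Y = texp D (?\<Phi> X) Y"
    by (simp add: hat_group_def inv)
qed

lemma hat_form_tensor:
  assumes "Vector_Spaces.linear (scl D) (scl D) \<phi>" "\<omega> \<noteq> 0"
  shows "hat_form D \<omega> \<phi> (tensor D x r) = tensor D (\<phi> x) (twist (inverse \<omega>) r)"
  using assms by (simp add: hat_form_def tscale_tensor tmap_tensor tensor_smult twist_def)

lemma hat_form_add:
  assumes "\<omega> \<noteq> 0"
  shows "hat_form D \<omega> \<phi> (X + Y) = hat_form D \<omega> \<phi> X + hat_form D \<omega> \<phi> Y"
  using assms by (simp add: hat_form_def tscale_add tmap_add vec.scale_right_distrib)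

lemma hat_form_0 [simp]: "\<omega> \<noteq> 0 \<Longrightarrow> hat_form D \<omega> \<phi> 0 = 0"
  using hat_form_add[of \<omega> \<phi> 0 0] by simp

lemma hat_form_minus: "\<omega> \<noteq> 0 \<Longrightarrow> hat_form D \<omega> \<phi> (- X) = - hat_form D \<omega> \<phi> X"
  using hat_form_add[of \<omega> \<phi> X "- X"] by (simp add: add_eq_0_iff)

lemma hat_form_diff:
  "\<omega> \<noteq> 0 \<Longrightarrow> hat_form D \<omega> \<phi> (X - Y) = hat_form D \<omega> \<phi> X - hat_form D \<omega> \<phi> Y"
  using hat_form_add[of \<omega> \<phi> X "- Y"] by (simp add: hat_form_minus)

lemma hat_form_sum:
  "\<omega> \<noteq> 0 \<Longrightarrow> hat_form D \<omega> \<phi> (\<Sum>i\<in>A. X i) = (\<Sum>i\<in>A. hat_form D \<omega> \<phi> (X i))"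
  by (induction A rule: infinite_finite_induct) (simp_all add: hat_form_add)

end

text \<open>No factor appears, since pulling back \<open>dt / (t - b)\<close> moves the pole and
  keeps the residue \<open>1\<close>.\<close>

lemma twist_rpole: "\<omega> \<noteq> 0 \<Longrightarrow> twist (inverse \<omega>) (rpole b) = rpole (\<omega> * b)"
  using rscale_rpole[of "inverse \<omega>" "\<omega> * b"]
  by (simp add: twist_def mult.assoc[symmetric] flip: rconst_mult)

context semisimple_lie_data
begin

text \<open>The inverse of \<omega> in the image of \<open>genE D i\<close> replaces the factor that
  \<open>dt\<close> contributes to \<open>hat_form\<close>. Therefore the \<open>f i\<close> are
  twisted exactly as in \<open>hat_form_sum_coroots\<close>, and invariance of the group element and
  of the new oper become the same condition.\<close>

lemma tmap_root_element:
  assumes \<sigma>: "twisted_automorphism D \<nu> \<omega> \<sigma>" and \<omega>: "\<omega> \<noteq> 0" and J: "bij_betw \<nu> J J" and \<nu>: "bij \<nu>"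
  shows "tmap D \<sigma> (tscale (inverse \<omega>) (root_element J f)) =
    root_element J (\<lambda>i. twist (inverse \<omega>) (f (inv \<nu> i)))"
proof -
  let ?\<Phi> = "\<lambda>X. tmap D \<sigma> (tscale (inverse \<omega>) X)"
  have lin: "Vector_Spaces.linear (scl D) (scl D) \<sigma>"
    using \<sigma> by (simp add: twisted_automorphism_def lie_automorphism_def)
  have add: "?\<Phi> (X + Y) = ?\<Phi> X + ?\<Phi> Y" for X Y
    using \<omega> by (simp add: tscale_add tmap_add)
  then have "?\<Phi> 0 = 0"
    by (metis add_cancel_right_right)
  then have sum: "?\<Phi> (\<Sum>i\<in>A. X i) = (\<Sum>i\<in>A. ?\<Phi> (X i))" for X and A :: "'c set"
    by (induction A rule: infinite_finite_induct) (simp_all add: add)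
  have "?\<Phi> (f i *s tconst D (genE D i)) = twist (inverse \<omega>) (f i) *s tconst D (genE D (\<nu> i))" for i
    using \<sigma> \<omega> unfolding tensor_tconst[symmetric]
    by (simp add: tscale_tensor tmap_tensor lin twisted_automorphism_def tensor_scl twist_def)
  then have "?\<Phi> (root_element J f) = (\<Sum>i\<in>J. twist (inverse \<omega>) (f i) *s tconst D (genE D (\<nu> i)))"
    unfolding root_element_def sum by simp
  also have "\<dots> = (\<Sum>i\<in>J. twist (inverse \<omega>) (f (inv \<nu> i)) *s tconst D (genE D i))"
    using \<nu> by (subst sum.reindex_bij_betw[OF J, symmetric]) (simp add: bij_is_inj)
  finally show ?thesis
    by (simp add: root_element_def)
qed

context
  fixes \<nu> :: "'c \<Rightarrow> 'c" and \<phi> :: "'a \<Rightarrow> 'a" and \<omega> :: complex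
  assumes \<phi>: "twisted_automorphism D \<nu> 1 \<phi>" and \<nu>: "bij \<nu>" and \<omega>: "\<omega> \<noteq> 0"
begin

lemma linear_automorphism: "Vector_Spaces.linear (scl D) (scl D) \<phi>"
  using \<phi> by (simp add: twisted_automorphism_def lie_automorphism_def)

lemma hat_form_sum_coroots:
  assumes J: "bij_betw \<nu> J J"
  shows "hat_form D \<omega> \<phi> (\<Sum>i\<in>J. f i *s tconst D (coroot D i)) =
    (\<Sum>i\<in>J. twist (inverse \<omega>) (f (inv \<nu> i)) *s tconst D (coroot D i))"
proof -
  have "hat_form D \<omega> \<phi> (\<Sum>i\<in>J. f i *s tconst D (coroot D i)) =
      (\<Sum>i\<in>J. twist (inverse \<omega>) (f i) *s tconst D (coroot D (\<nu> i)))"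
    using \<phi> unfolding tensor_tconst[symmetric]
    by (simp add: hat_form_sum \<omega> hat_form_tensor linear_automorphism twisted_automorphism_def)
  also have "\<dots> = (\<Sum>i\<in>J. twist (inverse \<omega>) (f (inv \<nu> i)) *s tconst D (coroot D i))"
    using \<nu> by (subst sum.reindex_bij_betw[OF J, symmetric]) (simp add: bij_is_inj)
  finally show ?thesis .
qed

lemma tpair_hat_form:
  assumes "X \<in> tspace D (csa D)"
  shows "tpair D (\<nu> i) (hat_form D \<omega> \<phi> X) = twist (inverse \<omega>) (tpair D i X)"
  using assms
proof (induction rule: tspace_induct)
  case (tensor x r)
  then show ?case
    using automorphism_csa_rt[OF \<phi> \<nu>] \<omega>
    by (simp add: hat_form_tensor linear_automorphism tpair_tensor twist_def rscale_mult mult.assoc)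
qed (use \<omega> in \<open>simp_all add: hat_form_add tpair_add twist_def rscale_add distrib_left\<close>)

text \<open>\<open>hat_form\<close> moves each summand to the next one, and the summands for
  \<open>r = T\<close> and \<open>r = 0\<close> coincide.\<close>

lemma hat_form_pole_sum:
  assumes "\<nu> ^^ T = id" "\<omega> ^ T = 1"
  shows "hat_form D \<omega> \<phi> (\<Sum>r<T. tensor D ((\<phi> ^^ r) a) (rpole (\<omega> ^ r * b))) =
    (\<Sum>r<T. tensor D ((\<phi> ^^ r) a) (rpole (\<omega> ^ r * b)))"
proof -
  let ?G = "\<lambda>r. tensor D ((\<phi> ^^ r) a) (rpole (\<omega> ^ r * b))"
  have "hat_form D \<omega> \<phi> (\<Sum>r<T. ?G r) = (\<Sum>r<T. ?G (Suc r))"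
    by (simp add: hat_form_sum \<omega> hat_form_tensor linear_automorphism twist_rpole mult.assoc)
  moreover have "(\<Sum>r<T. ?G r) + ?G T = ?G 0 + (\<Sum>r<T. ?G (Suc r))"
    using sum.lessThan_Suc_shift[of ?G T] sum.lessThan_Suc[of ?G T] by metis
  moreover have "?G T = ?G 0"
    using assms by (simp add: automorphism_funpow_id[OF \<phi> \<nu>])
  ultimately show ?thesis
    by simp
qed

end

end

text \<open>The size of the orbit is the first return time \<open>q\<close> of \<open>k\<close>. In
  \<open>diagram_orbits\<close> the orbit starts from some \<open>i\<close>; as a power of \<nu> is
  the identity, it may be restarted at \<open>k\<close>.\<close>

lemma diagram_orbit:
  fixes \<nu> :: "'i \<Rightarrow> 'i"
  assumes \<nu>: "bij \<nu>" and T: "T \<ge> 1" "\<nu> ^^ T = id" and J: "J \<in> diagram_orbits \<nu>" "k \<in> J"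
  shows "0 < card J" "(\<nu> ^^ card J) k = k" "J = (\<lambda>r. (\<nu> ^^ r) k) ` {..<card J}"
    "\<And>r. 0 < r \<Longrightarrow> r < card J \<Longrightarrow> (\<nu> ^^ r) k \<noteq> k" "\<And>n. (\<nu> ^^ n) k = k \<Longrightarrow> card J dvd n"
proof -
  define q where "q = (LEAST n. (\<nu> ^^ n) k = k \<and> 0 < n)"
  have "(\<nu> ^^ q) k = k \<and> 0 < q"
    unfolding q_def by (rule LeastI[of _ T]) (use T in simp)
  then have q: "(\<nu> ^^ q) k = k" "0 < q"
    by simp_all
  have qm: "(\<nu> ^^ (q * n)) k = k" for n
    using q by (induction n) (simp_all add: funpow_add)
  have mod: "(\<nu> ^^ n) k = (\<nu> ^^ (n mod q)) k" for n
    by (metis funpow_add mod_mult_div_eq o_apply qm)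
  have min: "q dvd n" if "(\<nu> ^^ n) k = k" for n
  proof (rule ccontr)
    assume "\<not> q dvd n"
    then have "(\<nu> ^^ (n mod q)) k = k \<and> 0 < n mod q"
      using that mod[of n] by (simp add: mod_greater_zero_iff_not_dvd)
    then have "q \<le> n mod q"
      unfolding q_def by (rule Least_le)
    then show False
      using mod_less_divisor[OF q(2), of n] by simp
  qed
  obtain i where i: "J = {(\<nu> ^^ r) i | r. True}"
    using J by (auto simp: diagram_orbits_def)
  then obtain s where s: "k = (\<nu> ^^ s) i"
    using J by auto
  have orbit: "J = range (\<lambda>r. (\<nu> ^^ r) k)"
  proof -
    have "(\<nu> ^^ r) i \<in> range (\<lambda>r. (\<nu> ^^ r) k)" for r
    proof -
      have "(\<nu> ^^ (T * n)) i = i" for n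
        using T by (simp add: funpow_mult[symmetric])
      \<comment> \<open>Full turns replace a negative power: \<open>\<nu> ^^ (T * s)\<close> fixes
        \<open>i\<close>, and \<open>T * s\<close> is large enough for \<open>s\<close> to be
        subtracted.\<close>
      moreover have "r + T * s = (r + T * s - s) + s"
        using T by (simp add: trans_le_add2)
      ultimately have "(\<nu> ^^ r) i = (\<nu> ^^ (r + T * s - s)) k"
        by (metis funpow_add o_apply s)
      then show ?thesis by blast
    qed
    moreover have "(\<nu> ^^ r) k \<in> J" for r
      unfolding i s by (auto simp: funpow_add[symmetric, THEN fun_cong, simplified])
    ultimately show ?thesis
      unfolding i by auto
  qed
  have J': "J = (\<lambda>r. (\<nu> ^^ r) k) ` {..<q}"
    unfolding orbit using mod q by (auto simp: image_iff) (metis lessThan_iff mod_less_divisor)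
  have "inj_on (\<lambda>r. (\<nu> ^^ r) k) {..<q}"
  proof (rule linorder_inj_onI)
    fix r r' assume "r < r'" "r \<in> {..<q}" "r' \<in> {..<q}"
    show "(\<nu> ^^ r) k \<noteq> (\<nu> ^^ r') k"
    proof
      assume "(\<nu> ^^ r) k = (\<nu> ^^ r') k"
      then have "(\<nu> ^^ r) k = (\<nu> ^^ r) ((\<nu> ^^ (r' - r)) k)"
        using \<open>r < r'\<close> by (metis funpow_add le_add_diff_inverse less_imp_le o_apply)
      then have "(\<nu> ^^ (r' - r)) k = k"
        using \<nu> by (metis bij_is_inj inj_fn injD)
      then have "q dvd r' - r"
        by (rule min)
      then show False
        using \<open>r < r'\<close> \<open>r' \<in> {..<q}\<close> by (auto dest: dvd_imp_le)
    qed
  qed auto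
  then have card: "card J = q"
    unfolding J' by (simp add: card_image)
  show "0 < card J" "(\<nu> ^^ card J) k = k" "J = (\<lambda>r. (\<nu> ^^ r) k) ` {..<card J}"
    unfolding card by (fact q J')+
  show "card J dvd n" if "(\<nu> ^^ n) k = k" for n
    using min[OF that] by (simp add: card)
  then show "(\<nu> ^^ r) k \<noteq> k" if "0 < r" "r < card J" for r
    using that by (auto dest: nat_dvd_not_less)
qed

lemma primitive_root_power_eq_1_iff:
  fixes \<omega> :: complex
  assumes "T \<ge> 1" "\<omega> ^ T = 1" "\<forall>n. 0 < n \<and> n < T \<longrightarrow> \<omega> ^ n \<noteq> 1"
  shows "\<omega> ^ n = 1 \<longleftrightarrow> T dvd n"
proof -
  have "\<omega> ^ n = \<omega> ^ (T * (n div T) + n mod T)"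
    by simp
  also have "\<dots> = \<omega> ^ (n mod T)"
    unfolding power_add power_mult by (simp add: assms)
  finally have "\<omega> ^ n = 1 \<longleftrightarrow> n mod T = 0"
    using assms by (cases "n mod T = 0") auto
  then show ?thesis
    by (simp add: dvd_eq_mod_eq_0)
qed

theorem theorem5p3:
  fixes D :: "('g::ab_group_add, 'n::finite, 'i::finite) lie_data"
    and \<nu> :: "'i \<Rightarrow> 'i" and \<nu>g \<sigma> :: "'g \<Rightarrow> 'g" and T :: nat and \<omega> :: complex
    and L m :: nat and z x :: "nat \<Rightarrow> complex"
    and lam :: "nat \<Rightarrow> 'g" and lam0 lam_inf :: 'g
    and w y :: "nat \<Rightarrow> 'g \<Rightarrow> 'g" and w_inf :: "'g \<Rightarrow> 'g"
    and u nab :: "ratfun ^ 'n"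
    and J :: "'i set" and js :: "'i list" and k :: 'i
    and f :: "'i \<Rightarrow> ratfun" and g :: "ratfun ^ 'n \<Rightarrow> ratfun ^ 'n" and s :: "'g \<Rightarrow> 'g"
  assumes "semisimple_lie_data D"
    and "diagram_automorphism D \<nu>"
    and "twisted_automorphism D \<nu> 1 \<nu>g"
    and "twisted_automorphism D \<nu> \<omega> \<sigma>"
    and "T \<ge> 1" and "\<nu> ^^ T = id"
    and "\<omega> ^ T = 1" and "\<forall>n. 0 < n \<and> n < T \<longrightarrow> \<omega> ^ n \<noteq> 1"
    and "\<forall>i\<in>{1..L}. z i \<noteq> 0"
    and "\<forall>i\<in>{1..L}. \<forall>j\<in>{1..L}. i \<noteq> j \<longrightarrow> (\<forall>r. z i \<noteq> \<omega> ^ r * z j)"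
    and "\<forall>j\<in>{1..m}. x j \<noteq> 0 \<and> (\<forall>i\<in>{1..L}. \<forall>r. x j \<noteq> \<omega> ^ r * z i)"
    and "\<forall>i\<in>{1..L}. integral_coweight D (lam i) \<and> dominant_coweight D (lam i)"
    and "integral_coweight D lam0" and "dominant_coweight D lam0" and "\<nu>g lam0 = lam0"
    and "integral_coweight D lam_inf" and "dominant_coweight D lam_inf" and "\<nu>g lam_inf = lam_inf"
    and "\<forall>i\<in>{1..L}. w i \<in> weyl D"
    and "\<forall>j\<in>{1..m}. y j \<in> weyl D"
    and "u = - tensor D lam0 (rpole 0)
           - (\<Sum>r<T. (\<Sum>i=1..L. tensor D ((\<nu>g ^^ r) (weyl_dot D (w i) (lam i))) (rpole (\<omega> ^ r * z i)))
                  + (\<Sum>j=1..m. tensor D ((\<nu>g ^^ r) (weyl_dot D (y j) 0)) (rpole (\<omega> ^ r * x j))))"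
    and "nab = tconst D (p_minus D) + u"
    and "\<forall>j\<in>{1..m}. oper_regular_at D \<omega> \<sigma> nab (x j)"
    and "w_inf \<in> weyl_inv D \<nu>g" and "tres_inf D u = weyl_dot D w_inf lam_inf"
    and "J \<in> diagram_orbits \<nu>" and "type_A1_power D J"
    and "distinct js" and "set js = J" and "k \<in> J"
    and "s = comp_prod (simple_refl D) js"
    and "f k \<noteq> 0" and "rderiv (f k) + (f k)\<^sup>2 + f k * tpair D k u = 0"
    and "\<forall>i\<in>J - {k}. f i = rconst (inverse \<omega>) * rscale (inverse \<omega>) (f (inv \<nu> i))"
    and "g = comp_prod (\<lambda>i. texp D (f i *s tconst D (genE D i))) js"
  shows "(regular_at 0 (f k) \<longrightarrow>
           (g \<in> inv_unip D \<omega> \<sigma> \<longleftrightarrow>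
              (\<exists>p :: int. rt D k (lam0 + rho D) = of_int p \<and> [p = 0] (mod int (T div card J)))) \<and>
           (gauge_act D g nab \<in> miura_opers D \<omega> \<nu>g \<longleftrightarrow>
              (\<exists>p :: int. rt D k (lam0 + rho D) = of_int p \<and> [p = 0] (mod int (T div card J)))) \<and>
           tres D 0 (conn_bar D (gauge_act D g nab)) = tres D 0 (conn_bar D nab)) \<and>
         (\<not> regular_at 0 (f k) \<longrightarrow>
           gauge_act D g nab \<in> miura_opers D \<omega> \<nu>g \<and>
           - tres D 0 (conn_bar D (gauge_act D g nab)) = weyl_dot D s (- tres D 0 (conn_bar D nab))) \<and>
         (rt D k (tres_inf D (conn_bar D nab) + rho D) \<in> \<real>\<^sub>\<ge>\<^sub>0 \<longrightarrow>
           tres_inf D (conn_bar D (gauge_act D g nab)) = weyl_dot D s (tres_inf D (conn_bar D nab)))"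
proof -
  interpret semisimple_lie_data D by fact
  have \<nu>: "bij \<nu>"
    using assms(2) by (simp add: diagram_automorphism_def)
  note \<nu>g = assms(3) and \<sigma> = assms(4)
  have \<omega>: "\<omega> \<noteq> 0"
    using assms(5,7) by (auto simp: power_0_left)
  note hat = hat_form_tensor[OF linear_automorphism[OF \<nu>g \<nu> \<omega>] \<omega>]
  define c where "c = inverse \<omega>"
  have c: "c \<noteq> 0"
    using \<omega> by (simp add: c_def)
  define q where "q = card J"
  note orbit = diagram_orbit[OF \<nu> assms(5,6,26,30), folded q_def]

  \<comment> \<open>The coefficient \<open>u\<close> and its pairings with simple roots\<close>
  have lam0: "lam0 \<in> csa D" and lam_inf: "lam_inf \<in> csa D" and lam: "\<And>i. i \<in> {1..L} \<Longrightarrow> lam i \<in> csa D"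
    using assms(12,13,16) by (auto simp: integral_coweight_def)
  \<comment> \<open>The poles away from the origin, one layer for each rotation.\<close>
  define P where "P r = (\<Sum>i=1..L. tensor D ((\<nu>g ^^ r) (weyl_dot D (w i) (lam i))) (rpole (\<omega> ^ r * z i)))
    + (\<Sum>j=1..m. tensor D ((\<nu>g ^^ r) (weyl_dot D (y j) 0)) (rpole (\<omega> ^ r * x j)))" for r
  have u: "u = - tensor D lam0 (rpole 0) - (\<Sum>r<T. P r)"
    using assms(21) by (simp add: P_def)
  have csa: "(\<nu>g ^^ r) (weyl_dot D (w i) (lam i)) \<in> csa D" if "i \<in> {1..L}" for r i
    using that assms(19) lam by (intro automorphism_funpow_csa[OF \<nu>g \<nu>] weyl_dot_csa) auto
  have csa': "(\<nu>g ^^ r) (weyl_dot D (y j) 0) \<in> csa D" if "j \<in> {1..m}" for r j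
    using that assms(20) csa_closed by (intro automorphism_funpow_csa[OF \<nu>g \<nu>] weyl_dot_csa) auto
  have u_csa: "u \<in> tspace D (csa D)"
    unfolding u P_def using csa csa' lam0 tensor_in_tspace[of _ "csa D"] unfolding tspace_def
    by (intro vec.span_diff vec.span_neg vec.span_sum vec.span_add) blast+
  have hat_u: "hat_form D \<omega> \<nu>g u = u"
  proof -
    \<comment> \<open>Interchanging the sums collects the full cycle of rotations of each marked
      point.\<close>
    let ?Q = "\<lambda>a b. \<Sum>r<T. tensor D ((\<nu>g ^^ r) a) (rpole (\<omega> ^ r * b))"
    have "(\<Sum>r<T. P r) = (\<Sum>i=1..L. ?Q (weyl_dot D (w i) (lam i)) (z i)) + (\<Sum>j=1..m. ?Q (weyl_dot D (y j) 0) (x j))"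
      unfolding P_def sum.distrib by (simp only: sum.swap[of _ "{..<T}"])
    then show ?thesis
      unfolding u by (simp add: hat_form_diff hat_form_minus hat_form_add hat_form_sum \<omega> hat twist_rpole
          assms(15) hat_form_pole_sum[OF \<nu>g \<nu> \<omega> assms(6,7)])
  qed
  define a where "a i = tpair D i u" for i
  have a_twist: "a (\<nu> i) = twist c (a i)" for i
    using tpair_hat_form[OF \<nu>g \<nu> \<omega> u_csa, of i] by (simp add: hat_u a_def c_def)

  have a_eq: "a i = - (rpole 0 * rconst (rt D i lam0)) - (\<Sum>r<T. tpair D i (P r))" for i
    by (simp add: a_def u tpair_diff tpair_minus tpair_sum tpair_tensor)
  \<comment> \<open>The range \<open>1-7\<close> leaves out the expansion of \<open>rpole\<close>,
    so that \<open>at_zero_rpole_nth\<close> still matches.\<close>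
  have P_zero: "fls_nth (at_zero (tpair D i (P r))) n = 0" if "n < 0" for i r n
    using that assms(9,11) \<omega>
    by (simp add: P_def tpair_add tpair_sum tpair_tensor at_zero_simps(1-7) fls_nth_sum at_zero_rpole_nth)
  have a_zero: "fls_nth (at_zero (a i)) n = 0" if "n < -1" for i n
    using that by (simp add: a_eq at_zero_simps(1-7) fls_nth_sum P_zero at_zero_rpole_0)
  have a_res: "rres 0 (a i) = - rt D i lam0" for i
    by (simp add: rres_0 a_eq at_zero_simps(1-7) fls_nth_sum P_zero at_zero_rpole_0)
  have a_inf: "fls_nth (at_inf (a i)) n = 0" if "n < 1" for i n
    using that by (simp add: a_eq P_def tpair_add tpair_sum tpair_tensor at_inf_simps(1-7) fls_nth_sum
        at_inf_rpole_nth)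

  \<comment> \<open>The orbit of \<open>k\<close> and the solutions along it\<close>
  define k' where "k' r = (\<nu> ^^ r) k" for r
  have k'_Suc: "k' (Suc r) = \<nu> (k' r)" and k'_0: "k' 0 = k" and k'_q: "k' q = k" for r
    using orbit(2) by (simp_all add: k'_def)
  have k'_J: "k' r \<in> J" if "r < q" for r
    using that orbit(3) by (auto simp: k'_def)
  have J_cases: "\<exists>r<q. i = k' r" if "i \<in> J" for i
    using that orbit(3) by (auto simp: k'_def)
  have bij_J: "bij_betw \<nu> J J"
  proof -
    have inj: "inj_on \<nu> J"
      by (rule inj_on_subset[OF bij_is_inj[OF \<nu>] subset_UNIV])
    have "\<nu> i \<in> J" if i: "i \<in> J" for i
    proof -
      obtain r where r: "r < q" "i = k' r"
        using J_cases[OF i] by blast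
      show ?thesis
      proof (cases "Suc r < q")
        case True
        then show ?thesis
          using k'_J[of "Suc r"] r by (simp add: k'_Suc)
      next
        case False
        then have "Suc r = q"
          using r by simp
        then show ?thesis
          using k'_Suc[of r] k'_q r assms(30) by simp
      qed
    qed
    then have "\<nu> ` J = J"
      using inj by (intro endo_inj_surj) auto
    then show ?thesis
      using inj by (simp add: bij_betw_def)
  qed
  \<comment> \<open>Not for \<open>r = q\<close>: there the formula would equate \<open>f k\<close>
    with its own \<open>q\<close>-fold twist, which is the closing condition below.\<close>
  have f_twist: "f (k' r) = (twist c ^^ r) (f k)" if "r < q" for r
    using that
  proof (induction r)
    case (Suc r)
    have "k' (Suc r) \<noteq> k"
      using orbit(4)[of "Suc r"] Suc.prems by (simp add: k'_def)
    then have "f (k' (Suc r)) = twist c (f (inv \<nu> (k' (Suc r))))"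
      using assms(34) k'_J[OF Suc.prems] by (simp add: twist_def c_def)
    then show ?case
      using Suc \<nu> by (simp add: k'_Suc bij_is_inj)
  qed (simp add: k'_0)
  have a_k': "a (k' r) = (twist c ^^ r) (a k)" for r
    by (induction r) (simp_all add: k'_0 k'_Suc a_twist)
  \<comment> \<open>For the coefficients the cycle always closes, because \<open>u\<close> is
    invariant. Hence \<open>f k\<close> and its \<open>q\<close>-fold twist solve the same
    equation.\<close>
  have a_period: "twist (c ^ q) (a k) = a k"
    using a_k'[of q] c by (simp add: k'_q twist_funpow)
  have riccati: "f i \<noteq> 0 \<and> rderiv (f i) + (f i)\<^sup>2 + f i * a i = 0" if i: "i \<in> J" for i
  proof -
    have "(twist c ^^ r) (f k) \<noteq> 0 \<and>
        rderiv ((twist c ^^ r) (f k)) + ((twist c ^^ r) (f k))\<^sup>2 + (twist c ^^ r) (f k) * a (k' r) = 0" for r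
      by (induction r) (use assms(32,33) c in \<open>simp_all add: k'_0 k'_Suc a_twist twist_riccati, simp add: a_def\<close>)
    then show ?thesis
      using J_cases[OF i] f_twist by metis
  qed
  have regular: "regular_at 0 (f i) \<longleftrightarrow> regular_at 0 (f k)" if i: "i \<in> J" for i
  proof -
    have "regular_at 0 ((twist c ^^ r) (f k)) \<longleftrightarrow> regular_at 0 (f k)" for r
      by (induction r) (simp_all add: regular_at_0_twist_iff c)
    then show ?thesis
      using J_cases[OF i] f_twist by metis
  qed

  \<comment> \<open>For \<open>i \<noteq> k\<close> these equations are the recursion itself, so
    only the one at \<open>k\<close> is a condition.\<close>
  define closes where "closes \<longleftrightarrow> (\<forall>i\<in>J. twist c (f (inv \<nu> i)) = f i)"
  have closes_iff: "closes \<longleftrightarrow> twist (c ^ q) (f k) = f k"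
  proof -
    have "twist (c ^ q) (f k) = twist c (f (inv \<nu> k))"
    proof -
      obtain r where r: "q = Suc r"
        using orbit(1) by (cases q) auto
      then have "inv \<nu> k = k' r"
        using k'_q k'_Suc[of r] \<nu> by (metis bij_is_inj inv_f_f)
      then show ?thesis
        using f_twist[of r] r c by (simp add: twist_funpow twist_twist)
    qed
    moreover have "twist c (f (inv \<nu> i)) = f i" if "i \<in> J - {k}" for i
      using that assms(34) by (simp add: twist_def c_def)
    ultimately show ?thesis
      using assms(30) by (auto simp: closes_def)
  qed

  \<comment> \<open>The gauge transformation and its invariance\<close>
  define X where "X = root_element J f"
  define H where "H = (\<Sum>i\<in>J. f i *s tconst D (coroot D i))"
  have g: "g = texp D X"
    using comp_prod_texp[OF assms(27,28), of f] assms(29,35) by (simp add: X_def)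
  have gauge: "gauge_act D g nab = tconst D (p_minus D) + (u + H)"
    unfolding g X_def assms(22) H_def
    using riccati by (intro gauge_act_root_element[OF assms(27) u_csa]) (simp add: a_def)
  have bar: "conn_bar D nab = u" "conn_bar D (gauge_act D g nab) = u + H"
    unfolding conn_bar_def gauge by (simp_all add: assms(22))
  have g_iff: "g \<in> inv_unip D \<omega> \<sigma> \<longleftrightarrow> closes"
  proof -
    have "hat_group D \<omega> \<sigma> g = texp D (root_element J (\<lambda>i. twist c (f (inv \<nu> i))))"
      using \<sigma> unfolding g X_def
      by (simp add: hat_group_texp[OF _ \<omega>] tmap_root_element[OF \<sigma> \<omega> bij_J \<nu>] twisted_automorphism_def c_def)
    then show ?thesis
      using texp_root_element_in_unip[OF assms(27), of f]
      by (simp add: inv_unip_def g X_def closes_def texp_root_element_eq_iff[OF assms(27)])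
  qed
  have miura_iff: "gauge_act D g nab \<in> miura_opers D \<omega> \<nu>g \<longleftrightarrow> closes"
  proof -
    have "u + H \<in> tspace D (csa D)"
      using u_csa sum_coroots_in_tspace[OF assms(27), of f] unfolding H_def tspace_def by (rule vec.span_add)
    then have "gauge_act D g nab \<in> miura_opers D \<omega> \<nu>g \<longleftrightarrow> hat_form D \<omega> \<nu>g (u + H) = u + H"
      by (auto simp: miura_opers_def gauge inv_forms_def)
    also have "\<dots> \<longleftrightarrow> hat_form D \<omega> \<nu>g H = H"
      by (simp add: hat_form_add \<omega> hat_u)
    also have "\<dots> \<longleftrightarrow> closes"
      unfolding H_def hat_form_sum_coroots[OF \<nu>g \<nu> \<omega> bij_J]
      by (simp add: sum_coroots_eq_iff[OF assms(27)] closes_def c_def)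
    finally show ?thesis .
  qed

  \<comment> \<open>Residues at the origin and at infinity\<close>
  have tres_H: "tres D 0 (u + H) = tres D 0 u + (\<Sum>i\<in>J. scl D (rres 0 (f i)) (coroot D i))"
    unfolding H_def tensor_tconst[symmetric]
    by (simp add: tres_eq tfunctional_add tfunctional_sum tfunctional_tensor rres_0_linear)
  have tres_inf_H: "tres_inf D (u + H) = tres_inf D u + (\<Sum>i\<in>J. scl D (rres_inf (f i)) (coroot D i))"
    unfolding H_def tensor_tconst[symmetric]
    by (simp add: tres_inf_eq tfunctional_add tfunctional_sum tfunctional_tensor rres_inf_linear)
  have s: "weyl_dot D s v = v - (\<Sum>i\<in>J. scl D (rt D i v + 1) (coroot D i))" for v
    unfolding assms(31) using assms(27,28,29)
    by (subst weyl_dot_comp_prod_simple_refl) (auto simp: type_A1_power_def)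
  have rt_tres: "rt D i (tres D 0 u) = rres 0 (a i)" and rt_tres_inf: "rt D i (tres_inf D u) = rres_inf (a i)" for i
    by (simp_all add: tres_eq tres_inf_eq rt_tfunctional rres_0_linear rres_inf_linear a_def)

  have local: "fls_subdegree (at_zero (f i)) = -1 \<and> rres 0 (f i) = 1 - rres 0 (a i) \<or>
    fls_subdegree (at_zero (f i)) \<ge> 0 \<and> of_int (fls_subdegree (at_zero (f i))) = - rres 0 (a i)"
    if "i \<in> J" for i
    using riccati[OF that] by (intro riccati_at_zero a_zero) auto

  \<comment> \<open>The three assertions\<close>
  have part1: "(closes \<longleftrightarrow> (\<exists>p :: int. rt D k (lam0 + rho D) = of_int p \<and> [p = 0] (mod int (T div card J)))) \<and>
    tres D 0 (u + H) = tres D 0 u" if reg: "regular_at 0 (f k)"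
  proof
    define e where "e = nat (fls_subdegree (at_zero (f k)))"
    have e: "fls_subdegree (at_zero (f k)) = int e" "of_nat e = rt D k lam0"
      using local[OF assms(30)] reg by (auto simp: regular_at_0_iff e_def a_res)
    have "q dvd T"
      using assms(6) by (intro orbit(5)) simp
    then obtain d where d: "T = q * d"
      by blast
    have "closes \<longleftrightarrow> (c ^ q) powi (int e + 1) = 1"
      using riccati_twist_iff[of "f k" "a k" "c ^ q"] riccati[OF assms(30)] a_zero a_period c reg closes_iff
      by (simp add: e(1))
    also have "(c ^ q) powi (int e + 1) = inverse (\<omega> ^ (q * (e + 1)))"
    proof -
      have "int e + 1 = int (e + 1)"
        by simp
      then show ?thesis
        by (simp only: power_int_of_nat c_def power_inverse power_mult)
    qed
    also have "inverse (\<omega> ^ (q * (e + 1))) = 1 \<longleftrightarrow> \<omega> ^ (q * (e + 1)) = 1"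
      by (metis inverse_1 inverse_inverse_eq)
    also have "\<dots> \<longleftrightarrow> T dvd q * (e + 1)"
      by (rule primitive_root_power_eq_1_iff[OF assms(5,7,8)])
    also have "\<dots> \<longleftrightarrow> int d dvd int (e + 1)"
      using orbit(1) by (simp only: d nat_mult_dvd_cancel_disj int_dvd_int_iff) simp
    also have "\<dots> \<longleftrightarrow> [int (e + 1) = 0] (mod int (T div card J))"
      using orbit(1) by (simp add: d q_def[symmetric] cong_0_iff)
    also have "\<dots> \<longleftrightarrow> (\<exists>p :: int. rt D k (lam0 + rho D) = of_int p \<and> [p = 0] (mod int (T div card J)))"
    proof -
      \<comment> \<open>The integer \<open>p\<close> can only be \<open>e + 1\<close>, since
        \<open>of_int\<close> is injective.\<close>
      have "rt D k (lam0 + rho D) = of_int (int (e + 1))"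
        by (simp add: rt_add rt_rho e(2)[symmetric])
      then show ?thesis
        by (metis of_int_eq_iff)
    qed
    finally show "closes \<longleftrightarrow> (\<exists>p :: int. rt D k (lam0 + rho D) = of_int p \<and> [p = 0] (mod int (T div card J)))" .
    show "tres D 0 (u + H) = tres D 0 u"
      unfolding tres_H using regular reg by (simp add: rres_0_regular)
  qed
  have part2: "closes \<and> - tres D 0 (u + H) = weyl_dot D s (- tres D 0 u)" if sing: "\<not> regular_at 0 (f k)"
  proof
    \<comment> \<open>This is where dominance of \<open>lam0\<close> enters.\<close>
    have "- rres 0 (a k) \<in> \<real>\<^sub>\<ge>\<^sub>0"
      using assms(14) by (simp add: a_res dominant_coweight_def)
    then show closes
      unfolding closes_iff using riccati[OF assms(30)] a_zero a_period c sing
      by (intro riccati_twist_singular[of "f k" "a k"]) auto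
    have "rres 0 (f i) = rt D i (- tres D 0 u) + 1" if "i \<in> J" for i
      using local[OF that] regular[OF that] sing by (auto simp: regular_at_0_iff rt_minus rt_tres)
    then show "- tres D 0 (u + H) = weyl_dot D s (- tres D 0 u)"
      unfolding tres_H s by simp
  qed
  have part3: "tres_inf D (u + H) = weyl_dot D s (tres_inf D u)"
    if pos: "rt D k (tres_inf D u + rho D) \<in> \<real>\<^sub>\<ge>\<^sub>0"
  proof -
    have w_inf: "w_inf \<in> weyl D" "\<And>v. v \<in> csa D \<Longrightarrow> \<nu>g (w_inf v) = w_inf (\<nu>g v)"
      using assms(24) by (auto simp: weyl_inv_def)
    let ?\<mu> = "tres_inf D u"
    have \<mu>: "?\<mu> \<in> csa D"
      unfolding assms(25) by (rule weyl_dot_csa[OF w_inf(1) lam_inf])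
    \<comment> \<open>The sign condition concerns \<open>k\<close> alone. The residue at infinity is
      invariant because \<open>lam_inf\<close> and \<open>rho D\<close> are and \<open>w_inf\<close>
      commutes with \<open>\<nu>g\<close>; so it pairs equally with all simple roots of the orbit,
      and the condition holds for each of them.\<close>
    have "\<nu>g (?\<mu> + rho D) = ?\<mu> + rho D"
      using w_inf(2)[of "lam_inf + rho D"] lam_inf rho_in_csa csa_closed assms(18,25)
      by (simp add: weyl_dot_def automorphism_linear[OF \<nu>g \<nu>] automorphism_rho[OF \<nu>g \<nu>])
    then have "\<nu>g ?\<mu> = ?\<mu>"
      by (simp add: automorphism_linear[OF \<nu>g \<nu>] automorphism_rho[OF \<nu>g \<nu>])
    then have rt_\<mu>: "rt D (\<nu> i) ?\<mu> = rt D i ?\<mu>" for i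
      using automorphism_csa_rt[OF \<nu>g \<nu> \<mu>, of i] by simp
    have "rt D (k' r) ?\<mu> = rt D k ?\<mu>" for r
      by (induction r) (simp_all add: k'_0 k'_Suc rt_\<mu>)
    then have "rt D i ?\<mu> = rt D k ?\<mu>" if "i \<in> J" for i
      using J_cases[OF that] by auto
    then have "rres_inf (f i) = - (rt D i ?\<mu> + 1)" if "i \<in> J" for i
      using pos riccati[OF that] a_inf that unfolding rt_tres_inf
      by (intro riccati_at_infinity) (simp_all add: rt_add rt_rho rt_tres_inf)
    then have "(\<Sum>i\<in>J. scl D (rres_inf (f i)) (coroot D i)) = - (\<Sum>i\<in>J. scl D (rt D i ?\<mu> + 1) (coroot D i))"
      unfolding sum_negf[symmetric] by (intro sum.cong refl) (simp only: V.scale_minus_left)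
    then show ?thesis
      unfolding tres_inf_H s by simp
  qed
  show ?thesis
    unfolding bar g_iff miura_iff using part1 part2 part3 by blast
qed

end
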